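(* Let $D=\{u_*>0\}$ be the hybrid $k$-quadrature domain, corresponding to density $(g,h)$, furnished by the construction recalled in the context. Let $k_0\ge0$ and let $u_0$ be any solution of $(\Delta+k_0^2)u_0=0$ in $\mathbb{R}^n$ such that $u_0>0$ on $\partial D$. Then there exist $\rho\in L^\infty(\mathbb{R}^n)$ with $|\rho|\ge c>0$ near $\partial D$ and $u_{\rho,g}\in C^{0,1}_{\rm loc}(\mathbb{R}^n)$ such that $$\begin{cases}(\Delta+k_0^2+\rho\chi_D)u_{\rho,g}=g\,\mathscr{H}^{n-1}\lfloor\partial D&\text{in }\mathbb{R}^n,\\ u_{\rho,g}=u_0&\text{in }\mathbb{R}^n\setminus D.\end{cases}$$
   Context: $n\ge2$; $B_r$ is the open ball of radius $r$ centered at the origin; $J_\nu$ is the Bessel function of the first kind and $j_{\nu,1}$ its first positive zero; $\mathscr{L}^n\lfloor D$ and $\mathscr{H}^{n-1}\lfloor\partial D$ are Lebesgue measure restricted to $D$ and $(n-1)$-dimensional Hausdorff measure on $\partial D$; equations with measures hold in the sense of distributions; $\mathscr{E}'(D)$ denotes distributions with compact support in $D$. Hybrid $k$-quadrature domain ($k>0$): a bounded open $D\subset\mathbb{R}^n$ with $\partial D$ of finite $(n-1)$-dimensional Hausdorff measure is a hybrid $k$-quadrature domain corresponding to $\mu\in\mathscr{E}'(D)$ and density $(g,h)\in L^\infty(\partial D)\times L^\infty(D)$ if, for all fundamental solutions $\Psi_k$ of $-(\Delta+k^2)$ (i.e. $-(\Delta+k^2)\Psi_k=\delta_0$ in $\mathscr{D}'(\mathbb{R}^n)$),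 $\big(\Psi_k*(g\mathscr{H}^{n-1}\lfloor\partial D)\big)(x)$ is well-defined pointwise for all $x\in\partial D$, and $\Psi_k*\mu=\Psi_k*(h\mathscr{L}^n\lfloor D+g\mathscr{H}^{n-1}\lfloor\partial D)$ in $\mathbb{R}^n\setminus D$. The construction. Fix $0<b\le b_0$, $0<\beta<j_{\frac{n-2}{2},1}$, $0<\epsilon<\beta$. Let $\mu$ be a non-negative measure vanishing outside $B_\epsilon$ with $\mu(\mathbb{R}^n)>C_nb_0\epsilon^n$, where $C_n\ge2^n\frac{(3\pi)^{n/2}}{\Gamma(1+n/2)}\frac{J_{n/2}(j_{\frac{n-2}{2},1})}{J_{n/2}(j_{\frac{n-2}{2},1}/3)}$. Let $0<k<\min\{\frac13,(C_{n,\beta}b/\mu(\mathbb{R}^n))^{1/n}\}$ with $C_{n,\beta}=(\frac{4\pi}{3})^{n/2}\beta^{n/2}J_{n/2}(\beta)\frac{J_{n/2}(\frac23j_{\frac{n-2}{2},1})}{J_{n/2}(j_{\frac{n-2}{2},1})}$, and $R=\beta k^{-1}$. Let $b\le h\le b_0$ in $B_R$, and let $g\in L^\infty(B_R)$ with $g\ge0$ and $g^2\in W^{1,1}(B_R)$; if $\partial\{g>0\}\cap B_R\ne\emptyset$, suppose there is $0<\alpha\le1$ such that $g$ is $C^\alpha$ near $\partial\{g>0\}\cap B_R$ and $\mathscr{H}^{n-1+\alpha}(\partial\{g>0\}\cap B_R)=0$. Under these assumptions the paper constructs a bounded open domain $D$, with $\partial D$ of finite $(n-1)$-dimensional Hausdorff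 measure and $\overline D\subset B_R$, which is a hybrid $k$-quadrature domain corresponding to $\mu$ and density $(g,h)$, together with a nonnegative function $u_*\in C^{0,1}_{\rm loc}(B_R)$ such that $D=\{u_*>0\}$ and $$(\Delta+k^2)u_*=-\tilde\mu+h\,\mathscr{L}^n\lfloor D+g\,\mathscr{H}^{n-1}\lfloor\partial D$$ for some non-negative $\tilde\mu\in L^\infty(D)\cap\mathscr{E}'(D)$. Here $\tilde\mu=\mu*\phi_{2\epsilon}$ with $\phi_{2\epsilon}=\big((2\pi)^{n/2}k^{-n/2}(2\epsilon)^{n/2}J_{n/2}(2k\epsilon)\big)^{-1}\chi_{B_{2\epsilon}}$, and $u_*$ is obtained as a minimizer, over $\{u\in H_0^1(B_R):u\ge0\}$, of $\int_{B_R}(|\nabla u|^2-k^2|u|^2-2fu+g^2\chi_{\{u>0\}})\,dx$ with $f=\tilde\mu-h\chi_D$. For $u\in H_0^1(B_R)$, $\{u>0\}$ is the set of all $x_0\in B_R$ for which there is a non-negative $\phi\in C_c^\infty(B_R)$ with $\phi(x_0)>0$ and $u\ge\phi$ in $B_R$. The function $u_*$ is extended by zero outside $B_R$. *)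

theory Defs
  imports "HOL-Analysis.Analysis"
begin

section \<open>Smooth functions and distributions\<close>

definition pd :: "'a::euclidean_space \<Rightarrow> ('a \<Rightarrow> 'b::real_normed_vector) \<Rightarrow> 'a \<Rightarrow> 'b" where
  "pd i f x = frechet_derivative f (at x) i"

fun pds :: "'a::euclidean_space list \<Rightarrow> ('a \<Rightarrow> 'b::real_normed_vector) \<Rightarrow> 'a \<Rightarrow> 'b" where
  "pds [] f = f"
| "pds (i # is) f = pd i (pds is f)"

text \<open>A derivative of order below \<open>m\<close> has continuous partial derivatives, so requiring it to be
  Frechet differentiable adds nothing to the classical definition of \<open>C\<^sup>m\<close>; it only makes
  \<open>frechet_derivative\<close> in \<open>pd\<close> meaningful.\<close>

definition C_k :: "nat \<Rightarrow> ('a::euclidean_space \<Rightarrow> 'b::real_normed_vector) \<Rightarrow> bool" where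
  "C_k m f \<longleftrightarrow> (\<forall>is\<in>lists Basis.
      (length is < m \<longrightarrow> (\<forall>x. pds is f differentiable (at x))) \<and>
      (length is \<le> m \<longrightarrow> continuous_on UNIV (pds is f)))"

definition smooth :: "('a::euclidean_space \<Rightarrow> 'b::real_normed_vector) \<Rightarrow> bool" where
  "smooth f \<longleftrightarrow> (\<forall>m. C_k m f)"

definition lap :: "('a::euclidean_space \<Rightarrow> 'b::real_normed_vector) \<Rightarrow> 'a \<Rightarrow> 'b" where
  "lap f x = (\<Sum>i\<in>Basis. pd i (pd i f) x)"

definition supp :: "('a::topological_space \<Rightarrow> 'b::zero) \<Rightarrow> 'a set" where
  "supp f = closure {x. f x \<noteq> 0}"

definition test_fun :: "'a::euclidean_space set \<Rightarrow> ('a \<Rightarrow> 'b::real_normed_vector) \<Rightarrow> bool" where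
  "test_fun \<Omega> \<phi> \<longleftrightarrow> smooth \<phi> \<and> compact (supp \<phi>) \<and> supp \<phi> \<subseteq> \<Omega>"

definition distribution :: "(('a::euclidean_space \<Rightarrow> complex) \<Rightarrow> complex) \<Rightarrow> bool" where
  "distribution T \<longleftrightarrow>
     (\<forall>\<phi> \<psi>. test_fun UNIV \<phi> \<and> test_fun UNIV \<psi> \<longrightarrow> T (\<lambda>x. \<phi> x + \<psi> x) = T \<phi> + T \<psi>) \<and>
     (\<forall>c \<phi>. test_fun UNIV \<phi> \<longrightarrow> T (\<lambda>x. c * \<phi> x) = c * T \<phi>) \<and>
     (\<forall>K. compact K \<longrightarrow> (\<exists>C m. \<forall>\<phi> B. test_fun UNIV \<phi> \<and> supp \<phi> \<subseteq> K \<and>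
        (\<forall>is\<in>lists Basis. length is \<le> m \<longrightarrow> (\<forall>x. norm (pds is \<phi> x) \<le> B))
        \<longrightarrow> norm (T \<phi>) \<le> C * B))"

definition dist_supp :: "(('a::euclidean_space \<Rightarrow> complex) \<Rightarrow> complex) \<Rightarrow> 'a set" where
  "dist_supp T = - \<Union>{U. open U \<and> (\<forall>\<phi>. test_fun U \<phi> \<longrightarrow> T \<phi> = 0)}"

definition compactly_supported_dist ::
    "'a::euclidean_space set \<Rightarrow> (('a \<Rightarrow> complex) \<Rightarrow> complex) \<Rightarrow> bool" where
  "compactly_supported_dist D T \<longleftrightarrow>
     distribution T \<and> compact (dist_supp T) \<and> dist_supp T \<subseteq> D"

text \<open>Pairing of a compactly supported distribution with a function that is smooth only in a
  neighbourhood of the support: evaluate at any test function agreeing with it near the support.\<close>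

definition dist_pairing ::
    "(('a::euclidean_space \<Rightarrow> complex) \<Rightarrow> complex) \<Rightarrow> ('a \<Rightarrow> complex) \<Rightarrow> complex" where
  "dist_pairing T f = (THE v. \<forall>\<phi> U. test_fun UNIV \<phi> \<and> open U \<and> dist_supp T \<subseteq> U \<and>
      (\<forall>y\<in>U. \<phi> y = f y) \<longrightarrow> T \<phi> = v)"

definition measure_dist :: "'a::euclidean_space measure \<Rightarrow> ('a \<Rightarrow> complex) \<Rightarrow> complex" where
  "measure_dist \<mu> \<phi> = (LINT x|\<mu>. \<phi> x)"

text \<open>The distribution \<open>(\<Delta> + k\<^sup>2) u\<close> of a (locally integrable) function \<open>u\<close>, applied to \<open>\<phi>\<close>.\<close>

definition helmholtz_dist :: "real \<Rightarrow> ('a::euclidean_space \<Rightarrow> real) \<Rightarrow> ('a \<Rightarrow> real) \<Rightarrow> real" where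
  "helmholtz_dist k u \<phi> = (LINT x|lebesgue. u x * (lap \<phi> x + k\<^sup>2 * \<phi> x))"


section \<open>Hausdorff measure\<close>

text \<open>The normalisation by \<open>unit_ball_vol s = \<pi> powr (s/2) / \<Gamma>(s/2+1)\<close> makes the
  measure of dimension \<open>n - 1\<close> the usual surface measure. Only exponents \<open>s > 0\<close> are meant
  (\<open>0 powr 0 = 0\<close>). The library diameter is meaningful for bounded sets only.\<close>

definition hausdorff_pre :: "real \<Rightarrow> real \<Rightarrow> 'a::metric_space set \<Rightarrow> ennreal" where
  "hausdorff_pre s \<delta> A =
     Inf {(\<Sum>i. ennreal (unit_ball_vol s * (diameter (U i) / 2) powr s)) | U :: nat \<Rightarrow> 'a set.
          A \<subseteq> (\<Union>i. U i) \<and> (\<forall>i. bounded (U i) \<and> diameter (U i) \<le> \<delta>)}"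

definition hausdorff_outer :: "real \<Rightarrow> 'a::metric_space set \<Rightarrow> ennreal" where
  "hausdorff_outer s A = (SUP \<delta>\<in>{0<..}. hausdorff_pre s \<delta> A)"

definition hausdorff_measure :: "real \<Rightarrow> 'a::metric_space measure" where
  "hausdorff_measure s = measure_of UNIV (sets borel) (hausdorff_outer s)"

definition boundary_measure :: "'a::euclidean_space set \<Rightarrow> 'a measure" where
  "boundary_measure D = restrict_space (hausdorff_measure (real DIM('a) - 1)) (frontier D)"


section \<open>Function spaces\<close>

definition L_infty :: "'a measure \<Rightarrow> ('a \<Rightarrow> real) \<Rightarrow> bool" where
  "L_infty M f \<longleftrightarrow> f \<in> borel_measurable M \<and> (\<exists>C. AE x in M. \<bar>f x\<bar> \<le> C)"

definition L_p :: "real \<Rightarrow> 'a::euclidean_space set \<Rightarrow> ('a \<Rightarrow> 'b::euclidean_space) \<Rightarrow> bool" where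
  "L_p p \<Omega> f \<longleftrightarrow> f \<in> borel_measurable (lebesgue_on \<Omega>) \<and>
     integrable (lebesgue_on \<Omega>) (\<lambda>x. norm (f x) powr p)"

definition L1_loc :: "'a::euclidean_space set \<Rightarrow> ('a \<Rightarrow> 'b::euclidean_space) \<Rightarrow> bool" where
  "L1_loc \<Omega> f \<longleftrightarrow> (\<forall>K. compact K \<and> K \<subseteq> \<Omega> \<longrightarrow> integrable (lebesgue_on K) f)"

definition weak_gradient ::
    "'a::euclidean_space set \<Rightarrow> ('a \<Rightarrow> real) \<Rightarrow> ('a \<Rightarrow> 'a) \<Rightarrow> bool" where
  "weak_gradient \<Omega> u w \<longleftrightarrow> L1_loc \<Omega> u \<and> L1_loc \<Omega> w \<and>
     (\<forall>\<phi>. test_fun \<Omega> \<phi> \<longrightarrow> (\<forall>i\<in>Basis.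
        (LINT x|lebesgue_on \<Omega>. u x * pd i \<phi> x) = - (LINT x|lebesgue_on \<Omega>. (w x \<bullet> i) * \<phi> x)))"

definition wgrad :: "'a::euclidean_space set \<Rightarrow> ('a \<Rightarrow> real) \<Rightarrow> 'a \<Rightarrow> 'a" where
  "wgrad \<Omega> u = (SOME w. weak_gradient \<Omega> u w)"

definition W1p :: "real \<Rightarrow> 'a::euclidean_space set \<Rightarrow> ('a \<Rightarrow> real) \<Rightarrow> bool" where
  "W1p p \<Omega> u \<longleftrightarrow> L_p p \<Omega> u \<and> (\<exists>w. weak_gradient \<Omega> u w \<and> L_p p \<Omega> w)"

text \<open>\<open>H\<^sub>0\<^sup>1(\<Omega>)\<close> as the closure of the test functions in \<open>H\<^sup>1(\<Omega>)\<close>.\<close>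

definition H10 :: "'a::euclidean_space set \<Rightarrow> ('a \<Rightarrow> real) \<Rightarrow> bool" where
  "H10 \<Omega> u \<longleftrightarrow> W1p 2 \<Omega> u \<and> (\<exists>\<phi> :: nat \<Rightarrow> 'a \<Rightarrow> real. (\<forall>j. test_fun \<Omega> (\<phi> j)) \<and>
     (\<lambda>j. LINT x|lebesgue_on \<Omega>. (\<phi> j x - u x)\<^sup>2) \<longlonglongrightarrow> 0 \<and>
     (\<lambda>j. LINT x|lebesgue_on \<Omega>. (norm ((\<Sum>i\<in>Basis. pd i (\<phi> j) x *\<^sub>R i) - wgrad \<Omega> u x))\<^sup>2)
        \<longlonglongrightarrow> 0)"

definition hoelder_loc :: "real \<Rightarrow> 'a::metric_space set \<Rightarrow> ('a \<Rightarrow> real) \<Rightarrow> bool" where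
  "hoelder_loc \<alpha> \<Omega> f \<longleftrightarrow> (\<forall>K. compact K \<and> K \<subseteq> \<Omega> \<longrightarrow>
     (\<exists>C. \<forall>x\<in>K. \<forall>y\<in>K. \<bar>f x - f y\<bar> \<le> C * dist x y powr \<alpha>))"

definition C01_loc :: "'a::metric_space set \<Rightarrow> ('a \<Rightarrow> real) \<Rightarrow> bool" where
  "C01_loc \<Omega> f \<longleftrightarrow> (\<forall>K. compact K \<and> K \<subseteq> \<Omega> \<longrightarrow> (\<exists>C. C-lipschitz_on K f))"


section \<open>Bessel functions\<close>

text \<open>Only used for \<open>x > 0\<close>.\<close>

definition bessel_J :: "real \<Rightarrow> real \<Rightarrow> real" where
  "bessel_J \<nu> x = (x / 2) powr \<nu> *
     (\<Sum>m. (-1) ^ m / (fact m * Gamma (real m + \<nu> + 1)) * (x / 2) ^ (2 * m))"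

definition bessel_zero :: "real \<Rightarrow> real" where
  "bessel_zero \<nu> = (LEAST x. 0 < x \<and> bessel_J \<nu> x = 0)"

text \<open>The reciprocal of the constant in front of the indicator function is the factor in the mean
  value property \<open>\<integral>\<^bsub>ball 0 r\<^esub> v = c * v 0\<close> of solutions of \<open>(\<Delta> + k\<^sup>2) v = 0\<close>.\<close>

definition mean_kernel :: "real \<Rightarrow> real \<Rightarrow> 'a::euclidean_space \<Rightarrow> real" where
  "mean_kernel k r x =
     inverse ((2 * pi) powr (real DIM('a) / 2) * k powr (- (real DIM('a) / 2)) *
              r powr (real DIM('a) / 2) * bessel_J (real DIM('a) / 2) (k * r)) *
     indicator (ball 0 r) x"

definition measure_conv ::
    "'a::euclidean_space measure \<Rightarrow> ('a \<Rightarrow> real) \<Rightarrow> 'a \<Rightarrow> real" where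
  "measure_conv \<mu> \<phi> x = (LINT y|\<mu>. \<phi> (x - y))"


section \<open>Hybrid quadrature domains\<close>

definition fundamental_solution ::
    "real \<Rightarrow> (('a::euclidean_space \<Rightarrow> complex) \<Rightarrow> complex) \<Rightarrow> bool" where
  "fundamental_solution k E \<longleftrightarrow> distribution E \<and>
     (\<forall>\<phi>. test_fun UNIV \<phi> \<longrightarrow> - E (\<lambda>x. lap \<phi> x + of_real (k\<^sup>2) * \<phi> x) = \<phi> 0)"

text \<open>By elliptic regularity a fundamental solution of \<open>-(\<Delta> + k\<^sup>2)\<close> is given by a locally
  integrable function that is smooth away from the origin. Pointwise values of convolutions refer
  to this function; its value at the origin is immaterial, since points are null sets.\<close>

definition represents ::
    "(('a::euclidean_space \<Rightarrow> complex) \<Rightarrow> complex) \<Rightarrow> ('a \<Rightarrow> complex) \<Rightarrow> bool" where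
  "represents E \<Psi> \<longleftrightarrow> L1_loc UNIV \<Psi> \<and> continuous_on (- {0}) \<Psi> \<and>
     (\<forall>\<phi>. test_fun UNIV \<phi> \<longrightarrow> E \<phi> = (LINT x|lebesgue. \<Psi> x * \<phi> x))"

definition hybrid_quadrature_domain ::
    "real \<Rightarrow> 'a::euclidean_space set \<Rightarrow> (('a \<Rightarrow> complex) \<Rightarrow> complex) \<Rightarrow> ('a \<Rightarrow> real) \<Rightarrow>
     ('a \<Rightarrow> real) \<Rightarrow> bool" where
  "hybrid_quadrature_domain k D \<mu> g h \<longleftrightarrow>
     bounded D \<and> open D \<and>
     emeasure (hausdorff_measure (real DIM('a) - 1)) (frontier D) < \<infinity> \<and>
     compactly_supported_dist D \<mu> \<and>
     L_infty (boundary_measure D) g \<and> L_infty (lebesgue_on D) h \<and>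
     (\<forall>E \<Psi>. fundamental_solution k E \<and> represents E \<Psi> \<longrightarrow>
        (\<forall>x\<in>frontier D. integrable (boundary_measure D) (\<lambda>y. \<Psi> (x - y) * of_real (g y))) \<and>
        (\<forall>x\<in>- D. dist_pairing \<mu> (\<lambda>y. \<Psi> (x - y)) =
           (LINT y|lebesgue_on D. \<Psi> (x - y) * of_real (h y)) +
           (LINT y|boundary_measure D. \<Psi> (x - y) * of_real (g y))))"


section \<open>The minimization problem\<close>

text \<open>\<open>{u > 0}\<close> for an element \<open>u\<close> of \<open>H\<^sub>0\<^sup>1(\<Omega>)\<close>.\<close>

definition positivity_set :: "'a::euclidean_space set \<Rightarrow> ('a \<Rightarrow> real) \<Rightarrow> 'a set" where
  "positivity_set \<Omega> u = {x0 \<in> \<Omega>. \<exists>\<phi> :: 'a \<Rightarrow> real. test_fun \<Omega> \<phi> \<and> (\<forall>x. 0 \<le> \<phi> x) \<and> 0 < \<phi> x0 \<and>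
     (AE x in lebesgue_on \<Omega>. \<phi> x \<le> u x)}"

definition energy ::
    "real \<Rightarrow> 'a::euclidean_space set \<Rightarrow> ('a \<Rightarrow> real) \<Rightarrow> ('a \<Rightarrow> real) \<Rightarrow> ('a \<Rightarrow> real) \<Rightarrow> real" where
  "energy k \<Omega> f g u = (LINT x|lebesgue_on \<Omega>.
     (norm (wgrad \<Omega> u x))\<^sup>2 - k\<^sup>2 * (u x)\<^sup>2 - 2 * f x * u x +
     (g x)\<^sup>2 * indicator (positivity_set \<Omega> u) x)"

definition energy_minimizer ::
    "real \<Rightarrow> 'a::euclidean_space set \<Rightarrow> ('a \<Rightarrow> real) \<Rightarrow> ('a \<Rightarrow> real) \<Rightarrow> ('a \<Rightarrow> real) \<Rightarrow> bool" where
  "energy_minimizer k \<Omega> f g u \<longleftrightarrow>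
     H10 \<Omega> u \<and> (AE x in lebesgue_on \<Omega>. 0 \<le> u x) \<and>
     (\<forall>v. H10 \<Omega> v \<and> (AE x in lebesgue_on \<Omega>. 0 \<le> v x) \<longrightarrow>
        energy k \<Omega> f g u \<le> energy k \<Omega> f g v)"

end

theory Submission
  imports Defs
begin

text \<open>Extended by zero, \<open>ustar\<close> already carries the prescribed surface measure: \<open>(\<Delta> + k\<^sup>2) ustar\<close> is
  the density \<open>g\<close> on \<open>frontier D\<close> plus the bounded function \<open>h - mut\<close> on \<open>D\<close>. One therefore looks for
  \<open>u = v + ustar\<close> with \<open>v\<close> of class \<open>C\<^sup>2\<close> and \<open>v = u0\<close> off \<open>D\<close>. Then \<open>(\<Delta> + k0\<^sup>2) u\<close> is the same surface
  measure plus \<open>F = (\<Delta> + k0\<^sup>2) v + (k0\<^sup>2 - k\<^sup>2) ustar + h - mut\<close> on \<open>D\<close>, and the equation asks for \<open>\<rho> = - F / u\<close> there.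

  The choice \<open>v = u0\<close> would work near \<open>frontier D\<close>, but \<open>u0\<close> may vanish inside \<open>D\<close>. It is therefore
  modified inside \<open>D\<close>, away from the boundary, into a function with a positive lower bound
  (\<open>positive_C2_modification\<close>); since \<open>ustar \<ge> 0\<close>, the quotient \<open>F / u\<close> is then bounded. Near
  \<open>frontier D\<close> both \<open>(\<Delta> + k0\<^sup>2) v\<close> and \<open>mut\<close> vanish and \<open>ustar\<close> is small, so there \<open>F\<close> is at least
  \<open>b / 2\<close>, which keeps \<open>\<rho>\<close> away from zero. This is \<open>transmission_potential\<close>.

  To make this rigorous, \<open>(\<Delta> + k0\<^sup>2) v\<close> is identified as a distribution by Green's second identity
  (\<open>green_second_identity\<close>); the equation of \<open>ustar\<close>, known only for test functions in the ball, is
  extended to the whole space by a smooth cutoff (\<open>helmholtz_dist_global\<close>); and \<open>D\<close>, defined by smooth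
  bumps below \<open>ustar\<close>, is the pointwise positivity set of the continuous function \<open>ustar\<close>
  (\<open>positivity_set_continuous\<close>), so that \<open>ustar\<close> vanishes off \<open>D\<close>. The cutoffs, the bumps and the
  modification of \<open>u0\<close> all come from one smooth step function built from \<open>exp (- 1 / t)\<close>.\<close>

section \<open>Calculus of iterated partial derivatives\<close>

lemma pd_eqI: "(f has_derivative f') (at x) \<Longrightarrow> pd i f x = f' i"
  unfolding pd_def by (metis frechet_derivative_at)

lemma has_derivative_pd: "f differentiable (at x) \<Longrightarrow> (f has_derivative (\<lambda>h. pd h f x)) (at x)"
  unfolding pd_def by (simp add: frechet_derivative_works[symmetric] eta_contract_eq)

text \<open>The sets of Frechet derivatives of \<open>f\<close> and of \<open>g\<close> at \<open>x\<close> coincide, hence also the derivative that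
  \<open>frechet_derivative\<close> chooses, be it a default value.\<close>
lemma pd_cong_open:
  assumes "open S" "x \<in> S" "\<And>y. y \<in> S \<Longrightarrow> f y = g y"
  shows "pd i f x = pd i g x"
proof -
  have "(f has_derivative f') (at x) \<longleftrightarrow> (g has_derivative f') (at x)" for f'
    using assms by (metis has_derivative_transform_within_open)
  then show ?thesis unfolding pd_def frechet_derivative_def by simp
qed

lemma pds_snoc: "pds (is @ [i]) f = pds is (pd i f)"
  by (induction "is") auto

lemma C_k_0: "C_k 0 f \<longleftrightarrow> continuous_on UNIV f"
  unfolding C_k_def by auto

text \<open>This recursion turns every closure property of \<open>C\<^sup>m\<close> below into an induction on \<open>m\<close>. Peeling off
  the derivative taken first is what makes the induction hypothesis applicable to \<open>pd i f\<close>.\<close>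
lemma C_k_Suc:
  "C_k (Suc m) f \<longleftrightarrow> (\<forall>x. f differentiable (at x)) \<and> (\<forall>i\<in>Basis. C_k m (pd i f))"
proof
  assume L: "C_k (Suc m) f"
  have "f differentiable (at x)" for x
    using L[unfolded C_k_def, rule_format, of "[]"] by auto
  moreover have "C_k m (pd i f)" if "i \<in> Basis" for i
    unfolding C_k_def
  proof (rule ballI)
    fix js :: "'a list" assume "js \<in> lists Basis"
    with that have "js @ [i] \<in> lists Basis" by auto
    from bspec[OF L[unfolded C_k_def] this]
    show "(length js < m \<longrightarrow> (\<forall>x. pds js (pd i f) differentiable at x)) \<and>
        (length js \<le> m \<longrightarrow> continuous_on UNIV (pds js (pd i f)))"
      by (simp add: pds_snoc)
  qed
  ultimately show "(\<forall>x. f differentiable (at x)) \<and> (\<forall>i\<in>Basis. C_k m (pd i f))" by blast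
next
  assume R: "(\<forall>x. f differentiable (at x)) \<and> (\<forall>i\<in>Basis. C_k m (pd i f))"
  show "C_k (Suc m) f"
    unfolding C_k_def
  proof (rule ballI)
    fix js :: "'a list" assume js: "js \<in> lists Basis"
    show "(length js < Suc m \<longrightarrow> (\<forall>x. pds js f differentiable at x)) \<and>
        (length js \<le> Suc m \<longrightarrow> continuous_on UNIV (pds js f))"
    proof (cases js rule: rev_exhaust)
      case Nil
      have "continuous_on UNIV f"
        using R differentiable_imp_continuous_within by (blast intro: continuous_at_imp_continuous_on)
      with R Nil show ?thesis by simp
    next
      case (snoc ks i)
      with js have "i \<in> Basis" "ks \<in> lists Basis" by auto
      with R snoc show ?thesis unfolding C_k_def by (auto simp: pds_snoc)
    qed
  qed
qed

lemma C_k_lower: "C_k (Suc m) f \<Longrightarrow> C_k m f"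
  unfolding C_k_def by auto

lemma C_k_continuous: "C_k m f \<Longrightarrow> continuous_on UNIV f"
  by (induction m) (auto simp: C_k_0 dest: C_k_lower)

text \<open>For functions defined by cases inside and outside an open set: the two cases must agree near the
  common boundary, which is expressed by overlapping open sets.\<close>
lemma C_k_glue:
  assumes "open S" "open T" "S \<union> T = UNIV" "C_k m g" "C_k m h"
    and "\<And>x. x \<in> S \<Longrightarrow> f x = g x" "\<And>x. x \<in> T \<Longrightarrow> f x = h x"
  shows "C_k m f"
  using assms(4-)
proof (induction m arbitrary: f g h)
  case 0
  have "continuous_on S f"
    using 0 by (metis C_k_0 continuous_on_cong continuous_on_subset subset_UNIV)
  moreover have "continuous_on T f"
    using 0 by (metis C_k_0 continuous_on_cong continuous_on_subset subset_UNIV)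
  ultimately show ?case
    using continuous_on_open_Un[of S T f] assms(1-3) by (auto simp: C_k_0)
next
  case (Suc m)
  have "f differentiable (at x)" for x
  proof (cases "x \<in> S")
    case True
    then have "(f has_derivative (\<lambda>h. pd h g x)) (at x)"
      using Suc.prems assms(1) by (metis C_k_Suc has_derivative_pd has_derivative_transform_within_open)
    then show ?thesis by (auto simp: differentiable_def)
  next
    case False
    then have "x \<in> T" using assms(3) by auto
    then have "(f has_derivative (\<lambda>k. pd k h x)) (at x)"
      using Suc.prems assms(2) by (metis C_k_Suc has_derivative_pd has_derivative_transform_within_open)
    then show ?thesis by (auto simp: differentiable_def)
  qed
  moreover have "C_k m (pd i f)" if "i \<in> Basis" for i
  proof (rule Suc.IH)
    show "C_k m (pd i g)" "C_k m (pd i h)" using Suc.prems that by (auto simp: C_k_Suc)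
    show "pd i f x = pd i g x" if "x \<in> S" for x
      using pd_cong_open[OF assms(1) that] Suc.prems by blast
    show "pd i f x = pd i h x" if "x \<in> T" for x
      using pd_cong_open[OF assms(2) that] Suc.prems by blast
  qed
  ultimately show ?case by (simp add: C_k_Suc)
qed

lemma C_k_const: "C_k m (\<lambda>x. c)"
proof (induction m arbitrary: c)
  case (Suc m)
  have "pd i (\<lambda>x. c) = (\<lambda>x. 0)" for i :: 'a by (rule ext, rule pd_eqI) auto
  then show ?case using Suc by (simp add: C_k_Suc)
qed (simp add: C_k_0)

lemma C_k_add: "C_k m f \<Longrightarrow> C_k m g \<Longrightarrow> C_k m (\<lambda>x. f x + g x)"
proof (induction m arbitrary: f g)
  case (Suc m)
  then have d: "f differentiable (at x)" "g differentiable (at x)" for x by (auto simp: C_k_Suc)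
  have "pd i (\<lambda>x. f x + g x) = (\<lambda>x. pd i f x + pd i g x)" for i
    by (rule ext, rule pd_eqI[OF has_derivative_add[OF has_derivative_pd[OF d(1)] has_derivative_pd[OF d(2)]]])
  then show ?case using Suc d by (auto simp: C_k_Suc)
qed (auto simp: C_k_0 intro: continuous_on_add)

lemma C_k_mult:
  fixes f g :: "'a::euclidean_space \<Rightarrow> real"
  shows "C_k m f \<Longrightarrow> C_k m g \<Longrightarrow> C_k m (\<lambda>x. f x * g x)"
proof (induction m arbitrary: f g)
  case (Suc m)
  then have d: "f differentiable (at x)" "g differentiable (at x)" for x by (auto simp: C_k_Suc)
  have "pd i (\<lambda>x. f x * g x) = (\<lambda>x. f x * pd i g x + pd i f x * g x)" for i
    by (rule ext, rule pd_eqI[OF has_derivative_mult[OF has_derivative_pd[OF d(1)] has_derivative_pd[OF d(2)]]])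
  moreover have "C_k m f" "C_k m g" using Suc.prems by (auto intro: C_k_lower)
  ultimately show ?case using Suc d by (auto simp: C_k_Suc intro!: C_k_add)
qed (auto simp: C_k_0 intro: continuous_on_mult)

lemma C_k_diff:
  fixes f g :: "'a::euclidean_space \<Rightarrow> real"
  shows "C_k m f \<Longrightarrow> C_k m g \<Longrightarrow> C_k m (\<lambda>x. f x - g x)"
  using C_k_add[of m f "\<lambda>x. (-1) * g x"] C_k_mult[OF C_k_const[of m "-1"], of g] by simp

lemma C_k_inverse:
  fixes f :: "'a::euclidean_space \<Rightarrow> real"
  assumes "\<And>x. f x \<noteq> 0"
  shows "C_k m f \<Longrightarrow> C_k m (\<lambda>x. inverse (f x))"
proof (induction m)
  case 0
  then show ?case using assms by (auto simp: C_k_0 intro!: continuous_on_inverse)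
next
  case (Suc m)
  then have d: "f differentiable (at x)" for x by (auto simp: C_k_Suc)
  have D: "((\<lambda>x. inverse (f x)) has_derivative (\<lambda>h. - (inverse (f x) * pd h f x * inverse (f x)))) (at x)" for x
    using Deriv.has_derivative_inverse[OF assms has_derivative_pd[OF d]] by simp
  have "pd i (\<lambda>x. inverse (f x)) = (\<lambda>x. 0 - inverse (f x) * pd i f x * inverse (f x))" for i
    by (rule ext, subst pd_eqI[OF D]) simp
  moreover have "C_k m (\<lambda>x. inverse (f x))" using Suc.prems Suc.IH by (auto intro: C_k_lower)
  then have "C_k m (\<lambda>x. 0 - inverse (f x) * pd i f x * inverse (f x))" if "i \<in> Basis" for i
    using Suc.prems that unfolding C_k_Suc by (intro C_k_diff C_k_mult C_k_const) auto
  ultimately show ?case using D unfolding C_k_Suc differentiable_def by metis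
qed

lemma C_k_compose:
  fixes \<psi> :: "real \<Rightarrow> real" and f :: "'a::euclidean_space \<Rightarrow> real"
  shows "C_k m \<psi> \<Longrightarrow> C_k m f \<Longrightarrow> C_k m (\<lambda>x. \<psi> (f x))"
proof (induction m arbitrary: \<psi>)
  case 0
  then show ?case
    by (auto simp: C_k_0 intro: continuous_on_compose2[of UNIV \<psi>])
next
  case (Suc m)
  then have d: "f differentiable (at x)" and e: "\<psi> differentiable (at y)" for x y
    by (auto simp: C_k_Suc)
  have D: "((\<lambda>x. \<psi> (f x)) has_derivative (\<lambda>h. pd (pd h f x) \<psi> (f x))) (at x)" for x
    using has_derivative_compose[OF has_derivative_pd[OF d] has_derivative_pd[OF e]] by simp
  have L: "pd r \<psi> y = r * pd 1 \<psi> y" for r y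
  proof -
    have "linear (\<lambda>h. pd h \<psi> y)" by (rule has_derivative_linear[OF has_derivative_pd[OF e]])
    from linear_cmul[OF this, of r 1] show ?thesis by simp
  qed
  have "pd i (\<lambda>x. \<psi> (f x)) = (\<lambda>x. pd i f x * pd 1 \<psi> (f x))" for i
    by (rule ext, subst pd_eqI[OF D]) (rule L)
  moreover have "C_k m f" "C_k m (pd 1 \<psi>)" using Suc.prems by (auto intro: C_k_lower simp: C_k_Suc)
  ultimately show ?case using Suc D
    unfolding C_k_Suc by (auto simp: differentiable_def intro!: C_k_mult)
qed

lemma C_k_inner_const: "C_k m (\<lambda>x. x \<bullet> c)"
proof (cases m)
  case (Suc k)
  have D: "((\<lambda>x. x \<bullet> c) has_derivative (\<lambda>h. h \<bullet> c)) (at x)" for x by (auto intro!: derivative_eq_intros)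
  have "pd i (\<lambda>x. x \<bullet> c) = (\<lambda>x. i \<bullet> c)" for i by (rule ext, rule pd_eqI[OF D])
  then show ?thesis using D by (auto simp: Suc C_k_Suc C_k_const differentiable_def)
qed (auto simp: C_k_0 intro!: continuous_intros)

lemma C_k_norm_square: "C_k m (\<lambda>x. (norm (x - a))\<^sup>2)"
proof (cases m)
  case (Suc k)
  have D: "((\<lambda>x. (norm (x - a))\<^sup>2) has_derivative (\<lambda>h. 2 * (h \<bullet> (x - a)))) (at x)" for x
    unfolding power2_norm_eq_inner
    by (auto intro!: derivative_eq_intros simp: inner_commute)
  have "pd i (\<lambda>x. (norm (x - a))\<^sup>2) = (\<lambda>x. 2 * (x \<bullet> i - a \<bullet> i))" for i
    by (rule ext, subst pd_eqI[OF D]) (simp add: inner_diff_right inner_commute[of i])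
  then show ?thesis using D
    by (auto simp: Suc C_k_Suc differentiable_def intro!: C_k_mult C_k_const C_k_diff C_k_inner_const)
qed (auto simp: C_k_0 intro!: continuous_intros)

section \<open>Smooth steps and cutoffs\<close>

text \<open>The derivative of \<open>exp (- 1 / t)\<close> is a combination of products of the same function with powers of
  \<open>1 / t\<close>; considering all these products at once makes the family closed under differentiation.\<close>
definition flat :: "nat \<Rightarrow> real \<Rightarrow> real" where
  "flat k t = (if t \<le> 0 then 0 else inverse t ^ k * exp (- inverse t))"

lemma flat_tendsto_0: "(flat k \<longlongrightarrow> 0) (at 0)"
proof -
  have "((\<lambda>y. y ^ k / exp y) \<longlongrightarrow> (0::real)) at_top" by (rule tendsto_power_div_exp_0)
  then have "((\<lambda>t. inverse t ^ k / exp (inverse t)) \<longlongrightarrow> (0::real)) (at_right 0)"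
    by (rule filterlim_compose) (rule filterlim_inverse_at_top_right)
  then have "(flat k \<longlongrightarrow> 0) (at_right 0)"
    by (rule Lim_transform_eventually)
       (auto simp: eventually_at_filter flat_def exp_minus divide_inverse)
  moreover have "(flat k \<longlongrightarrow> 0) (at_left 0)"
    by (rule tendsto_eventually) (auto simp: eventually_at_filter flat_def)
  ultimately show ?thesis by (simp add: filterlim_split_at)
qed

lemma flat_deriv:
  "(flat k has_real_derivative flat (k + 2) t - real k * flat (k + 1) t) (at t)"
proof -
  consider "t < 0" | "t = 0" | "t > 0" by linarith
  then show ?thesis
  proof cases
    case 1
    have "((\<lambda>t. 0) has_real_derivative 0) (at t)" by simp
    then have "(flat k has_real_derivative 0) (at t)"
      by (rule has_field_derivative_transform_within_open[of _ _ _ "{..<0}"]) (use 1 in \<open>auto simp: flat_def\<close>)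
    with 1 show ?thesis by (simp add: flat_def)
  next
    case 2
    have "((\<lambda>h. flat (Suc k) h) \<longlongrightarrow> 0) (at 0)" by (rule flat_tendsto_0)
    then have "((\<lambda>h. (flat k (0 + h) - flat k 0) / h) \<longlongrightarrow> 0) (at 0)"
      by (rule Lim_transform_eventually) (auto simp: eventually_at_filter flat_def field_simps)
    with 2 show ?thesis by (simp add: DERIV_def flat_def)
  next
    case 3
    have P: "((\<lambda>t. inverse t ^ k) has_real_derivative - (real k * inverse t ^ (k + 1))) (at t)"
    proof (induction k)
      case (Suc k)
      from DERIV_mult[OF DERIV_inverse[of t UNIV] Suc] 3
      show ?case by (simp add: algebra_simps power2_eq_square)
    qed simp
    have E: "((\<lambda>t. exp (- inverse t)) has_real_derivative exp (- inverse t) * inverse t ^ 2) (at t)"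
      using 3 by (auto intro!: derivative_eq_intros simp: power2_eq_square)
    have "((\<lambda>t. inverse t ^ k * exp (- inverse t)) has_real_derivative
        (inverse t ^ (k + 2) * exp (- inverse t) - real k * (inverse t ^ (k + 1) * exp (- inverse t)))) (at t)"
      using DERIV_mult[OF P E] by (simp add: algebra_simps power2_eq_square)
    then have "(flat k has_real_derivative
        (inverse t ^ (k + 2) * exp (- inverse t) - real k * (inverse t ^ (k + 1) * exp (- inverse t)))) (at t)"
      by (rule has_field_derivative_transform_within_open[of _ _ _ "{0<..}"]) (use 3 in \<open>auto simp: flat_def\<close>)
    with 3 show ?thesis by (simp add: flat_def)
  qed
qed

lemma C_k_flat: "C_k m (flat k)"
proof (induction m arbitrary: k)
  case 0
  show ?case unfolding C_k_0 continuous_on_eq_continuous_at[OF open_UNIV]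
    using flat_deriv DERIV_isCont by blast
next
  case (Suc m)
  have D: "(flat k has_derivative (\<lambda>h. h * (flat (k + 2) t - real k * flat (k + 1) t))) (at t)" for t
    using flat_deriv[of k t] by (simp add: has_field_derivative_def mult_commute_abs)
  have "pd 1 (flat k) = (\<lambda>t. flat (k + 2) t - real k * flat (k + 1) t)"
    by (rule ext, subst pd_eqI[OF D]) simp
  then show ?case using Suc D
    unfolding C_k_Suc by (auto simp: differentiable_def intro!: C_k_diff C_k_mult C_k_const)
qed

text \<open>The function \<open>flat 0\<close> is positive exactly on the positive axis. As \<open>a < b\<close>, the terms \<open>flat 0 (t - a)\<close>
  and \<open>flat 0 (b - t)\<close> never vanish together, so the share of the first in their sum is a smooth step.\<close>
lemma smooth_step_exists:
  fixes a b :: real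
  assumes "a < b"
  shows "\<exists>\<sigma> :: real \<Rightarrow> real. smooth \<sigma> \<and> (\<forall>t. 0 \<le> \<sigma> t) \<and> (\<forall>t. \<sigma> t \<le> 1) \<and>
    (\<forall>t\<le>a. \<sigma> t = 0) \<and> (\<forall>t\<ge>b. \<sigma> t = 1)"
proof (intro exI conjI allI impI)
  define q where "q t = flat 0 (t - a) + flat 0 (b - t)" for t
  define \<sigma> where "\<sigma> t = flat 0 (t - a) * inverse (q t)" for t
  have nn: "0 \<le> flat 0 t" for t by (simp add: flat_def)
  have q: "q t > 0" for t
    using assms by (cases "t \<le> a") (auto simp: q_def flat_def add_pos_pos)
  have id: "C_k m (\<lambda>t::real. t)" for m using C_k_inner_const[of m "1::real"] by simp
  have "C_k m q" for m
    unfolding q_def by (intro C_k_add C_k_compose[OF C_k_flat] C_k_diff id C_k_const)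
  then show "smooth \<sigma>"
    unfolding smooth_def \<sigma>_def using q
    by (intro allI C_k_mult C_k_inverse C_k_compose[OF C_k_flat] C_k_diff id C_k_const) (auto simp: less_le)
  show "0 \<le> \<sigma> t" "\<sigma> t \<le> 1" for t
    using nn[of "t - a"] nn[of "b - t"] q[of t] unfolding \<sigma>_def q_def by (auto simp: field_simps)
  show "\<sigma> t = 0" if "t \<le> a" for t using that by (simp add: \<sigma>_def flat_def)
  show "\<sigma> t = 1" if "b \<le> t" for t using that q[of t] by (simp add: \<sigma>_def q_def flat_def)
qed

lemma smooth_ball_cutoff_exists:
  fixes a :: "'a::euclidean_space"
  assumes "0 \<le> r" "r < s"
  shows "\<exists>\<eta> :: 'a \<Rightarrow> real. smooth \<eta> \<and> (\<forall>x. 0 \<le> \<eta> x) \<and> (\<forall>x. \<eta> x \<le> 1) \<and>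
    (\<forall>x\<in>cball a r. \<eta> x = 1) \<and> supp \<eta> \<subseteq> cball a s"
proof -
  have "- s\<^sup>2 < - r\<^sup>2" using power_strict_mono[OF assms(2,1), of 2] by simp
  then obtain \<sigma> where \<sigma>: "smooth \<sigma>" "\<And>t. 0 \<le> \<sigma> t" "\<And>t. \<sigma> t \<le> 1"
    "\<And>t. t \<le> - s\<^sup>2 \<Longrightarrow> \<sigma> t = (0::real)" "\<And>t. - r\<^sup>2 \<le> t \<Longrightarrow> \<sigma> t = 1"
    using smooth_step_exists[of "- s\<^sup>2" "- r\<^sup>2"] by blast
  let ?\<eta> = "\<lambda>x. \<sigma> (0 - (norm (x - a))\<^sup>2)"
  show ?thesis
  proof (intro exI[of _ ?\<eta>] conjI allI ballI)
    have "C_k m (\<lambda>x. 0 - (norm (x - a))\<^sup>2)" for m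
      by (intro C_k_diff C_k_const C_k_norm_square)
    then show "smooth ?\<eta>" using \<sigma>(1) C_k_compose[of _ \<sigma>] unfolding smooth_def by blast
    show "0 \<le> ?\<eta> x" "?\<eta> x \<le> 1" for x using \<sigma> by auto
    show "?\<eta> x = 1" if "x \<in> cball a r" for x
      using that by (intro \<sigma>(5)) (auto simp: dist_norm norm_minus_commute intro: power_mono)
    have "{x. ?\<eta> x \<noteq> 0} \<subseteq> cball a s"
    proof safe
      fix x assume nz: "?\<eta> x \<noteq> 0"
      have "\<not> s \<le> norm (x - a)" using nz \<sigma>(4) power_mono[of s "norm (x - a)" 2] assms by auto
      then show "x \<in> cball a s" by (simp add: dist_norm norm_minus_commute)
    qed
    then show "supp ?\<eta> \<subseteq> cball a s" unfolding supp_def by (rule closure_minimal) simp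
  qed
qed

section \<open>Integration by parts\<close>

lemma supp_zero: "x \<notin> supp f \<Longrightarrow> f x = 0"
  using closure_subset[of "{x. f x \<noteq> 0}"] by (auto simp: supp_def)

lemma continuous_bounded_on_compact:
  fixes f :: "'a::topological_space \<Rightarrow> real"
  assumes "continuous_on K f" "compact K"
  shows "\<exists>M>0. \<forall>x\<in>K. \<bar>f x\<bar> \<le> M"
  using compact_imp_bounded[OF compact_continuous_image[OF assms]] unfolding bounded_pos by auto

lemma lebesgue_lborel_integral:
  fixes f :: "'a::euclidean_space \<Rightarrow> real"
  assumes "continuous_on UNIV f"
  shows "integral\<^sup>L lebesgue f = integral\<^sup>L lborel f"
  using borel_measurable_continuous_onI[OF assms] by (intro integral_completion) simp

lemma integrable_compact_support:
  fixes f :: "'a::euclidean_space \<Rightarrow> real"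
  assumes "continuous_on UNIV f" "compact K" "\<And>x. x \<notin> K \<Longrightarrow> f x = 0"
  shows "integrable lborel f"
proof -
  have "integrable lborel (\<lambda>x. indicator K x *\<^sub>R f x)"
    using assms(1,2) by (intro borel_integrable_compact) (auto intro: continuous_on_subset)
  moreover have "(\<lambda>x. indicator K x *\<^sub>R f x) = f" using assms(3) by (intro ext) (auto simp: indicator_def)
  ultimately show ?thesis by simp
qed

text \<open>By translation invariance, every difference quotient of \<open>f\<close> in direction \<open>i\<close> has integral \<open>0\<close>. The mean
  value theorem bounds these quotients by the maximum of the derivative on a compact set, so
  dominated convergence passes to the limit.\<close>
lemma integral_pd_zero:
  fixes f :: "'a::euclidean_space \<Rightarrow> real"
  assumes d: "\<And>x. f differentiable (at x)" and c: "continuous_on UNIV (pd i f)"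
    and K: "compact K" "\<And>x. x \<notin> K \<Longrightarrow> f x = 0"
  shows "(LINT x|lebesgue. pd i f x) = 0"
proof -
  have cf: "continuous_on UNIV f"
    using d by (intro differentiable_imp_continuous_on) (simp add: differentiable_on_def)
  have bf: "f \<in> borel_measurable borel" by (rule borel_measurable_continuous_onI[OF cf])
  have intf: "integrable lborel f" by (rule integrable_compact_support[OF cf K])
  obtain r where r: "K \<subseteq> cball 0 r" using compact_imp_bounded[OF K(1)] by (auto simp: bounded_iff subset_iff)
  define s where "s m x = (f (x + (1 / real (Suc m)) *\<^sub>R i) - f x) * real (Suc m)" for m x
  have D: "((\<lambda>t. f (x + t *\<^sub>R i)) has_real_derivative pd i f (x + t *\<^sub>R i)) (at t)" for x t
  proof -
    let ?y = "x + t *\<^sub>R i"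
    have lin: "pd (h *\<^sub>R i) f ?y = h * pd i f ?y" for h
      using linear_cmul[OF has_derivative_linear[OF has_derivative_pd[OF d[of ?y]]], of h i] by simp
    have "((\<lambda>t. x + t *\<^sub>R i) has_derivative (\<lambda>h. h *\<^sub>R i)) (at t)" by (auto intro!: derivative_eq_intros)
    from has_derivative_compose[OF this has_derivative_pd[OF d]]
    have "((\<lambda>t. f (x + t *\<^sub>R i)) has_derivative (\<lambda>h. h * pd i f ?y)) (at t)" by (simp add: lin)
    then show ?thesis by (simp add: has_field_derivative_def mult_commute_abs)
  qed
  obtain M where M: "\<And>x. x \<in> cball 0 (r + 2 * norm i) \<Longrightarrow> \<bar>pd i f x\<bar> \<le> M"
    using continuous_bounded_on_compact[OF continuous_on_subset[OF c] compact_cball] by (metis subset_UNIV)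
  have "(\<lambda>m. integral\<^sup>L lborel (s m)) \<longlonglongrightarrow> integral\<^sup>L lborel (pd i f)"
  proof (rule integral_dominated_convergence)
    show "pd i f \<in> borel_measurable lborel" using borel_measurable_continuous_onI[OF c] by simp
    show "s m \<in> borel_measurable lborel" for m using bf unfolding s_def by measurable
    show "integrable lborel (\<lambda>x. M * indicator (cball 0 (r + norm i)) x :: real)"
      using emeasure_lborel_cball_finite by (intro integrable_mult_right integrable_real_indicator) auto
    show "AE x in lborel. (\<lambda>m. s m x) \<longlonglongrightarrow> pd i f x"
    proof (rule AE_I2)
      fix x
      have "((\<lambda>t. (f (x + t *\<^sub>R i) - f x) / t) \<longlongrightarrow> pd i f x) (at 0)"
        using D[of x 0] by (simp add: DERIV_def)
      moreover have "filterlim (\<lambda>m. 1 / real (Suc m)) (at 0) sequentially"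
        using LIMSEQ_inverse_real_of_nat by (auto simp: filterlim_at inverse_eq_divide)
      ultimately have "(\<lambda>m. (f (x + (1 / real (Suc m)) *\<^sub>R i) - f x) / (1 / real (Suc m))) \<longlonglongrightarrow> pd i f x"
        by (rule filterlim_compose)
      then show "(\<lambda>m. s m x) \<longlonglongrightarrow> pd i f x" unfolding s_def by simp
    qed
    show "AE x in lborel. norm (s m x) \<le> M * indicator (cball 0 (r + norm i)) x" for m
    proof (rule AE_I2)
      fix x
      let ?t = "1 / real (Suc m)"
      have t: "0 < ?t" "?t \<le> 1" by auto
      show "norm (s m x) \<le> M * indicator (cball 0 (r + norm i)) x"
      proof (cases "x \<in> cball 0 (r + norm i)")
        case True
        obtain z where z: "0 < z" "z < ?t" "f (x + ?t *\<^sub>R i) - f (x + 0 *\<^sub>R i) = (?t - 0) * pd i f (x + z *\<^sub>R i)"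
          using MVT2[OF t(1), of "\<lambda>t. f (x + t *\<^sub>R i)" "\<lambda>t. pd i f (x + t *\<^sub>R i)"] D by blast
        then have "s m x = pd i f (x + z *\<^sub>R i)" unfolding s_def by simp
        moreover have "z \<le> 1" using z t by linarith
        then have "norm (z *\<^sub>R i) \<le> norm i" using z mult_right_mono[of z 1 "norm i"] by simp
        then have "x + z *\<^sub>R i \<in> cball 0 (r + 2 * norm i)"
          using True norm_triangle_ineq[of x "z *\<^sub>R i"] by simp
        ultimately show ?thesis using M True by simp
      next
        case False
        then have x: "r + norm i < norm x" by simp
        have "norm (?t *\<^sub>R i) \<le> norm i" using t mult_right_mono[of ?t 1 "norm i"] by simp
        moreover have "norm x \<le> norm (x + ?t *\<^sub>R i) + norm (?t *\<^sub>R i)"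
          using norm_triangle_ineq4[of "x + ?t *\<^sub>R i" "?t *\<^sub>R i"] by (simp only: add_diff_cancel_right')
        ultimately have "r < norm (x + ?t *\<^sub>R i)" using x by linarith
        moreover have "r < norm x" using x norm_ge_zero[of i] by linarith
        ultimately have "x + ?t *\<^sub>R i \<notin> K" "x \<notin> K" using r by force+
        then show ?thesis using False K(2) by (simp add: s_def)
      qed
    qed
  qed
  moreover have "integral\<^sup>L lborel (s m) = 0" for m
  proof -
    let ?c = "(1 / real (Suc m)) *\<^sub>R i"
    have "integral\<^sup>L lborel f = integral\<^sup>L (distr lborel borel ((+) ?c)) f"
      by (simp only: lborel_distr_plus)
    also have "\<dots> = (LINT x|lborel. f (?c + x))" using bf by (intro integral_distr) auto
    finally have e: "(LINT x|lborel. f (x + ?c)) = integral\<^sup>L lborel f" by (simp add: add.commute)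
    have "integrable (distr lborel borel ((+) ?c)) f" using intf by (simp only: lborel_distr_plus)
    then have "integrable lborel (\<lambda>x. f (?c + x))" using bf by (subst (asm) integrable_distr_eq) auto
    then have "integrable lborel (\<lambda>x. f (x + ?c))" by (simp add: add.commute)
    then show ?thesis using e intf unfolding s_def by simp
  qed
  ultimately have "integral\<^sup>L lborel (pd i f) = 0" by (simp add: LIMSEQ_const_iff)
  then show ?thesis using lebesgue_lborel_integral[OF c] by simp
qed

lemma continuous_on_lap:
  fixes v :: "'a::euclidean_space \<Rightarrow> real"
  assumes "C_k 2 v" shows "continuous_on UNIV (lap v)"
  unfolding lap_def[abs_def]
  by (intro continuous_on_sum) (use assms in \<open>auto simp: numeral_2_eq_2 C_k_Suc C_k_0\<close>)

lemma pd_zero_off_supp: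
  fixes \<phi> :: "'a::euclidean_space \<Rightarrow> real"
  assumes "x \<notin> supp \<phi>" shows "pd i \<phi> x = 0"
proof -
  have "pd i \<phi> x = pd i (\<lambda>_. 0) x"
    using assms supp_zero by (intro pd_cong_open[of "- supp \<phi>"]) (auto simp: supp_def)
  also have "\<dots> = 0" by (rule pd_eqI) auto
  finally show ?thesis .
qed

lemma supp_pd: "supp (pd i \<phi>) \<subseteq> supp (\<phi> :: 'a::euclidean_space \<Rightarrow> real)"
  unfolding supp_def[of "pd i \<phi>"] using pd_zero_off_supp
  by (intro closure_minimal) (auto simp: supp_def)

text \<open>The difference of the two integrands is the divergence of the compactly supported \<open>C\<^sup>1\<close> field with
  components \<open>v * pd i \<phi> - pd i v * \<phi>\<close>, so its integral vanishes.\<close>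
lemma green_second_identity:
  fixes v \<phi> :: "'a::euclidean_space \<Rightarrow> real"
  assumes v: "C_k 2 v" and \<phi>: "C_k 2 \<phi>" "compact (supp \<phi>)"
  shows "(LINT x|lebesgue. v x * lap \<phi> x) = (LINT x|lebesgue. lap v x * \<phi> x)"
proof -
  have 1: "v differentiable (at x)" "\<phi> differentiable (at x)"
    "i \<in> Basis \<Longrightarrow> pd i v differentiable (at x)" "i \<in> Basis \<Longrightarrow> pd i \<phi> differentiable (at x)"
    "i \<in> Basis \<Longrightarrow> continuous_on UNIV (pd i (pd i v))" "i \<in> Basis \<Longrightarrow> continuous_on UNIV (pd i (pd i \<phi>))"
    for x i using v \<phi> by (auto simp: numeral_2_eq_2 C_k_Suc C_k_0)
  have cont: "continuous_on UNIV v" "continuous_on UNIV \<phi>" using v \<phi> C_k_continuous by auto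
  have off: "lap \<phi> x = 0" if "x \<notin> supp \<phi>" for x
    using that supp_pd[of _ \<phi>] by (auto simp: lap_def intro!: sum.neutral pd_zero_off_supp)
  have cl: "continuous_on UNIV (\<lambda>x. v x * lap \<phi> x)" "continuous_on UNIV (\<lambda>x. lap v x * \<phi> x)"
    by (intro continuous_on_mult cont continuous_on_lap v \<phi>)+
  have int: "integrable lborel (\<lambda>x. v x * lap \<phi> x)" "integrable lborel (\<lambda>x. lap v x * \<phi> x)"
    by (rule integrable_compact_support[OF cl(1) \<phi>(2)] integrable_compact_support[OF cl(2) \<phi>(2)];
        simp add: off supp_zero)+
  define W where "W i x = v x * pd i \<phi> x - pd i v x * \<phi> x" for i x
  have pW: "pd i (W i) x = v x * pd i (pd i \<phi>) x - pd i (pd i v) x * \<phi> x" if "i \<in> Basis" for i x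
  proof -
    have "(W i has_derivative (\<lambda>h. (v x * pd h (pd i \<phi>) x + pd h v x * pd i \<phi> x)
        - (pd i v x * pd h \<phi> x + pd h (pd i v) x * \<phi> x))) (at x)"
      unfolding W_def using that 1
      by (intro has_derivative_diff has_derivative_mult has_derivative_pd)
    from pd_eqI[OF this, of i] show ?thesis by simp
  qed
  have "(LINT x|lebesgue. pd i (W i) x) = 0" if i: "i \<in> Basis" for i
  proof (rule integral_pd_zero)
    show "W i differentiable (at x)" for x
      unfolding W_def using i 1 by (intro differentiable_diff differentiable_mult)
    show "continuous_on UNIV (pd i (W i))"
      unfolding pW[OF i, abs_def] using i 1 cont by (intro continuous_on_diff continuous_on_mult)
    show "compact (supp \<phi>)" by fact
    show "W i x = 0" if "x \<notin> supp \<phi>" for x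
      using that by (simp add: W_def pd_zero_off_supp supp_zero)
  qed
  moreover have iW: "integrable lborel (pd i (W i))" and cW: "continuous_on UNIV (pd i (W i))"
    if i: "i \<in> Basis" for i
  proof -
    show c: "continuous_on UNIV (pd i (W i))"
      unfolding pW[OF i, abs_def] using i 1 cont by (intro continuous_on_diff continuous_on_mult)
    show "integrable lborel (pd i (W i))"
    proof (rule integrable_compact_support[OF c \<phi>(2)])
      fix x assume x: "x \<notin> supp \<phi>"
      then have "pd i (pd i \<phi>) x = 0" using supp_pd[of i \<phi>] by (auto intro: pd_zero_off_supp)
      with x show "pd i (W i) x = 0" by (simp add: pW[OF i] supp_zero)
    qed
  qed
  ultimately have z: "integral\<^sup>L lborel (pd i (W i)) = 0" if "i \<in> Basis" for i
    using lebesgue_lborel_integral[OF cW] that by simp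
  have "(LINT x|lborel. v x * lap \<phi> x) - (LINT x|lborel. lap v x * \<phi> x)
      = (LINT x|lborel. v x * lap \<phi> x - lap v x * \<phi> x)"
    using int by simp
  also have "\<dots> = (LINT x|lborel. (\<Sum>i\<in>Basis. pd i (W i) x))"
    by (intro Bochner_Integration.integral_cong refl)
       (simp add: pW lap_def sum_subtractf sum_distrib_left sum_distrib_right)
  also have "\<dots> = (\<Sum>i\<in>Basis. integral\<^sup>L lborel (pd i (W i)))"
    by (intro Bochner_Integration.integral_sum iW)
  also have "\<dots> = 0" using z by simp
  finally show ?thesis using lebesgue_lborel_integral[OF cl(1)] lebesgue_lborel_integral[OF cl(2)] by simp
qed

section \<open>The Helmholtz operator in the sense of distributions\<close>

lemma lap_cong_open:
  assumes "open S" "x \<in> S" "\<And>y. y \<in> S \<Longrightarrow> f y = g y"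
  shows "lap f x = lap g x"
proof -
  have "pd i (pd i f) x = pd i (pd i g) x" for i
    by (rule pd_cong_open[OF assms(1,2)], rule pd_cong_open[OF assms(1)]) (use assms(3) in auto)
  then show ?thesis by (simp add: lap_def)
qed

lemma continuous_measurable_lebesgue:
  fixes f :: "'a::euclidean_space \<Rightarrow> real"
  assumes "continuous_on UNIV f"
  shows "f \<in> borel_measurable lebesgue"
  using borel_measurable_continuous_onI[OF assms] by (intro measurable_completion) simp

lemma integrable_bounded_mult_test:
  fixes q \<phi> :: "'a::euclidean_space \<Rightarrow> real"
  assumes q: "q \<in> borel_measurable lebesgue" "AE x in lebesgue. \<bar>q x\<bar> \<le> C"
    and \<phi>: "continuous_on UNIV \<phi>" "compact (supp \<phi>)"
  shows "integrable lebesgue (\<lambda>x. q x * \<phi> x)"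
proof (rule Bochner_Integration.integrable_bound)
  have "integrable lborel (\<lambda>x. C * \<phi> x)"
    using \<phi> by (intro integrable_compact_support[OF _ \<phi>(2)]) (auto simp: supp_zero intro: continuous_intros)
  then show "integrable lebesgue (\<lambda>x. C * \<phi> x)"
    by (subst integrable_completion) (auto intro: borel_measurable_integrable)
  show "(\<lambda>x. q x * \<phi> x) \<in> borel_measurable lebesgue"
    using q(1) continuous_measurable_lebesgue[OF \<phi>(1)] by (rule borel_measurable_times)
  show "AE x in lebesgue. norm (q x * \<phi> x) \<le> norm (C * \<phi> x)"
    using q(2) by eventually_elim (auto simp: abs_mult intro!: mult_right_mono)
qed

lemma integrable_continuous_mult_test:
  fixes f \<phi> :: "'a::euclidean_space \<Rightarrow> real"
  assumes f: "continuous_on UNIV f" and \<phi>: "continuous_on UNIV \<phi>" "compact (supp \<phi>)"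
  shows "integrable lebesgue (\<lambda>x. f x * \<phi> x)"
proof -
  have c: "continuous_on UNIV (\<lambda>x. f x * \<phi> x)" using f \<phi> by (intro continuous_on_mult)
  have "integrable lborel (\<lambda>x. f x * \<phi> x)"
    by (rule integrable_compact_support[OF c \<phi>(2)]) (simp add: supp_zero)
  then show ?thesis using borel_measurable_continuous_onI[OF c]
    by (subst integrable_completion) auto
qed

lemma compact_supp_lap:
  fixes \<phi> :: "'a::euclidean_space \<Rightarrow> real"
  assumes "compact (supp \<phi>)"
  shows "compact (supp (lap \<phi>))"
proof -
  have "lap \<phi> x = 0" if "x \<notin> supp \<phi>" for x
    using that supp_pd[of _ \<phi>] by (auto simp: lap_def intro!: sum.neutral pd_zero_off_supp)
  then have "supp (lap \<phi>) \<subseteq> supp \<phi>"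
    unfolding supp_def[of "lap \<phi>"] by (intro closure_minimal) (auto simp: supp_def)
  moreover have "closed (supp (lap \<phi>))" by (simp add: supp_def)
  ultimately show ?thesis using assms compact_Int_closed by (metis inf.absorb_iff2)
qed

lemma test_fun_realD:
  fixes \<phi> :: "'a::euclidean_space \<Rightarrow> real"
  assumes "test_fun \<Omega> \<phi>"
  shows "C_k m \<phi>" "continuous_on UNIV \<phi>" "compact (supp \<phi>)" "continuous_on UNIV (lap \<phi>)"
    "compact (supp (lap \<phi>))"
  using assms C_k_continuous continuous_on_lap compact_supp_lap unfolding test_fun_def smooth_def by blast+

lemma helmholtz_dist_split:
  fixes u \<phi> :: "'a::euclidean_space \<Rightarrow> real"
  assumes u: "continuous_on UNIV u" and \<phi>: "test_fun \<Omega> \<phi>"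
  shows "helmholtz_dist k u \<phi> = (LINT x|lebesgue. u x * lap \<phi> x) + k\<^sup>2 * (LINT x|lebesgue. u x * \<phi> x)"
proof -
  have "helmholtz_dist k u \<phi> = (LINT x|lebesgue. u x * lap \<phi> x + k\<^sup>2 * (u x * \<phi> x))"
    unfolding helmholtz_dist_def by (simp add: algebra_simps)
  then show ?thesis
    using integrable_continuous_mult_test[OF u test_fun_realD(4,5)[OF \<phi>]]
      integrable_continuous_mult_test[OF u test_fun_realD(2,3)[OF \<phi>]] by simp
qed

lemma helmholtz_dist_add:
  fixes u v \<phi> :: "'a::euclidean_space \<Rightarrow> real"
  assumes u: "continuous_on UNIV u" and v: "continuous_on UNIV v" and \<phi>: "test_fun \<Omega> \<phi>"
  shows "helmholtz_dist k (\<lambda>x. u x + v x) \<phi> = helmholtz_dist k u \<phi> + helmholtz_dist k v \<phi>"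
  using integrable_continuous_mult_test[OF u test_fun_realD(2,3)[OF \<phi>]]
    integrable_continuous_mult_test[OF u test_fun_realD(4,5)[OF \<phi>]]
    integrable_continuous_mult_test[OF v test_fun_realD(2,3)[OF \<phi>]]
    integrable_continuous_mult_test[OF v test_fun_realD(4,5)[OF \<phi>]]
  by (simp add: helmholtz_dist_split[OF u \<phi>] helmholtz_dist_split[OF v \<phi>]
      helmholtz_dist_split[OF continuous_on_add[OF u v] \<phi>] distrib_right distrib_left)

lemma helmholtz_dist_C2:
  fixes v \<phi> :: "'a::euclidean_space \<Rightarrow> real"
  assumes v: "C_k 2 v" and \<phi>: "test_fun \<Omega> \<phi>"
  shows "helmholtz_dist k v \<phi> = (LINT x|lebesgue. (lap v x + k\<^sup>2 * v x) * \<phi> x)"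
proof -
  have c: "continuous_on UNIV v" by (rule C_k_continuous[OF v])
  have "(LINT x|lebesgue. (lap v x + k\<^sup>2 * v x) * \<phi> x)
      = (LINT x|lebesgue. lap v x * \<phi> x + k\<^sup>2 * (v x * \<phi> x))" by (simp add: algebra_simps)
  also have "\<dots> = (LINT x|lebesgue. lap v x * \<phi> x) + k\<^sup>2 * (LINT x|lebesgue. v x * \<phi> x)"
    using integrable_continuous_mult_test[OF continuous_on_lap[OF v] test_fun_realD(2,3)[OF \<phi>]]
      integrable_continuous_mult_test[OF c test_fun_realD(2,3)[OF \<phi>]] by simp
  finally show ?thesis
    using helmholtz_dist_split[OF c \<phi>] green_second_identity[OF v test_fun_realD(1,3)[OF \<phi>]] by simp
qed

text \<open>An equation tested in \<open>ball 0 R\<close> only also holds against all test functions once everything lives on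
  \<open>closure D\<close>: multiply the test function by a cutoff that is \<open>1\<close> near \<open>closure D\<close>.\<close>
lemma helmholtz_dist_global:
  fixes w q :: "'a::euclidean_space \<Rightarrow> real"
  assumes r: "0 < r" "r < R" "D \<subseteq> ball 0 r" and w: "\<And>x. x \<notin> D \<Longrightarrow> w x = 0"
    and q: "\<And>x. x \<notin> D \<Longrightarrow> q x = 0"
    and eq: "\<And>\<phi>. test_fun (ball 0 R) \<phi> \<Longrightarrow>
      helmholtz_dist k w \<phi> = (LINT x|lebesgue. q x * \<phi> x) + (LINT x|boundary_measure D. g x * \<phi> x)"
    and fr: "frontier D \<subseteq> ball 0 r"
    and \<phi>: "test_fun UNIV \<phi>"
  shows "helmholtz_dist k w \<phi> = (LINT x|lebesgue. q x * \<phi> x) + (LINT x|boundary_measure D. g x * \<phi> x)"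
proof -
  obtain \<eta> :: "'a \<Rightarrow> real" where \<eta>: "smooth \<eta>" "\<forall>x\<in>cball 0 r. \<eta> x = 1" "supp \<eta> \<subseteq> cball 0 ((r + R) / 2)"
    using smooth_ball_cutoff_exists[of r "(r + R) / 2" 0] r by auto
  let ?\<psi> = "\<lambda>x. \<eta> x * \<phi> x"
  have "supp ?\<psi> \<subseteq> supp \<eta>" unfolding supp_def by (rule closure_mono) auto
  also have "\<dots> \<subseteq> cball 0 ((r + R) / 2)" by (rule \<eta>(3))
  finally have s: "supp ?\<psi> \<subseteq> cball 0 ((r + R) / 2)" .
  then have "compact (supp ?\<psi>)"
    unfolding supp_def compact_eq_bounded_closed using bounded_subset[OF bounded_cball] by blast
  moreover have "supp ?\<psi> \<subseteq> ball 0 R" using s r by fastforce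
  moreover have "smooth ?\<psi>"
    using \<eta>(1) \<phi> unfolding test_fun_def smooth_def by (auto intro: C_k_mult)
  ultimately have "test_fun (ball 0 R) ?\<psi>" by (simp add: test_fun_def)
  note E = eq[OF this]
  have same: "?\<psi> x = \<phi> x" if "x \<in> ball 0 r" for x using \<eta>(2) that by simp
  have "lap ?\<psi> x = lap \<phi> x" if "x \<in> ball 0 r" for x
    using that same by (intro lap_cong_open[of "ball 0 r"]) auto
  then have "w x * (lap ?\<psi> x + k\<^sup>2 * ?\<psi> x) = w x * (lap \<phi> x + k\<^sup>2 * \<phi> x)" for x
    using w[of x] r(3) same[of x] by (cases "x \<in> D") auto
  then have "helmholtz_dist k w ?\<psi> = helmholtz_dist k w \<phi>" unfolding helmholtz_dist_def
    by (intro Bochner_Integration.integral_cong refl)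
  moreover have "q x * ?\<psi> x = q x * \<phi> x" for x
    using q[of x] r(3) same[of x] by (cases "x \<in> D") auto
  moreover have "(LINT x|boundary_measure D. g x * ?\<psi> x) = (LINT x|boundary_measure D. g x * \<phi> x)"
  proof (rule Bochner_Integration.integral_cong[OF refl])
    fix x assume "x \<in> space (boundary_measure D)"
    then have "x \<in> ball 0 r" using fr by (auto simp: boundary_measure_def space_restrict_space)
    then show "g x * ?\<psi> x = g x * \<phi> x" using same by simp
  qed
  ultimately show ?thesis using E by simp
qed

section \<open>Locally Lipschitz functions and positivity sets\<close>

lemma open_superlevel:
  fixes f :: "'a::topological_space \<Rightarrow> real"
  assumes "open S" "continuous_on S f"
  shows "open {x \<in> S. c < f x}"
proof -
  have "{x \<in> S. c < f x} = S \<inter> f -` {c<..}" by auto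
  then show ?thesis using continuous_open_preimage[OF assms(2,1), of "{c<..}"] by simp
qed

lemma C01_loc_continuous_on:
  fixes u :: "'a::euclidean_space \<Rightarrow> real"
  assumes "C01_loc \<Omega> u" "open \<Omega>"
  shows "continuous_on \<Omega> u"
proof (rule continuous_at_imp_continuous_on, rule ballI)
  fix x assume "x \<in> \<Omega>"
  then obtain e where e: "0 < e" "cball x e \<subseteq> \<Omega>" using assms(2) open_contains_cball by blast
  then obtain C where "C-lipschitz_on (cball x e) u"
    using assms(1) unfolding C01_loc_def by (meson compact_cball)
  then have "continuous_on (cball x e) u" by (rule lipschitz_on_continuous_on)
  then show "isCont u x" using e(1) by (intro continuous_on_interior[of "cball x e"]) auto
qed

text \<open>If \<open>\<phi> \<le> u\<close> almost everywhere and both are continuous, the inequality holds everywhere, since a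
  nonempty open set is not a null set. Conversely, near a point where \<open>u > 0\<close> there is room for a small
  smooth bump below \<open>u\<close>; away from it \<open>u \<ge> 0\<close> is enough.\<close>
lemma positivity_set_continuous:
  assumes "open \<Omega>" "continuous_on \<Omega> u" "\<And>x. x \<in> \<Omega> \<Longrightarrow> 0 \<le> u x"
  shows "positivity_set \<Omega> u = {x \<in> \<Omega>. 0 < u x}"
proof safe
  fix x assume "x \<in> positivity_set \<Omega> u"
  then obtain \<phi> :: "'a \<Rightarrow> real" where \<phi>: "test_fun \<Omega> \<phi>" "0 < \<phi> x" "x \<in> \<Omega>"
    "AE y in lebesgue_on \<Omega>. \<phi> y \<le> u y" unfolding positivity_set_def by blast
  show "x \<in> \<Omega>" by fact
  show "0 < u x"
  proof (rule ccontr)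
    assume "\<not> 0 < u x"
    let ?S = "{y \<in> \<Omega>. 0 < \<phi> y - u y}"
    have "continuous_on \<Omega> \<phi>"
      using \<phi>(1) C_k_continuous continuous_on_subset unfolding test_fun_def smooth_def by blast
    then have op: "open ?S"
      using assms by (intro open_superlevel) (auto intro: continuous_on_diff)
    moreover have "x \<in> ?S" using \<phi> \<open>\<not> 0 < u x\<close> by auto
    moreover have "?S \<in> null_sets lebesgue"
    proof -
      have "AE y in lebesgue. y \<in> \<Omega> \<longrightarrow> \<phi> y \<le> u y"
        using \<phi>(4) assms(1) by (subst (asm) AE_restrict_space_iff) auto
      then have "AE y in lebesgue. y \<notin> ?S" by eventually_elim auto
      then show ?thesis using op by (subst AE_iff_null_sets) auto
    qed
    ultimately show False using open_not_negligible[of ?S] negligible_iff_null_sets by blast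
  qed
next
  fix x assume x: "x \<in> \<Omega>" "0 < u x"
  obtain s where s: "s > 0" "cball x s \<subseteq> {y \<in> \<Omega>. u x / 2 < u y}"
    using open_superlevel[OF assms(1,2), of "u x / 2"] x unfolding open_contains_cball by force
  obtain \<eta> :: "'a \<Rightarrow> real" where \<eta>: "smooth \<eta>" "\<And>y. 0 \<le> \<eta> y" "\<And>y. \<eta> y \<le> 1"
    "\<And>y. y \<in> cball x 0 \<Longrightarrow> \<eta> y = 1" "supp \<eta> \<subseteq> cball x s"
    using smooth_ball_cutoff_exists[of 0 s x] s(1) by blast
  let ?\<phi> = "\<lambda>y. u x / 2 * \<eta> y"
  have supp: "supp ?\<phi> \<subseteq> cball x s"
    using \<eta>(5) x unfolding supp_def by simp
  then have "compact (supp ?\<phi>)"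
    unfolding supp_def compact_eq_bounded_closed using bounded_subset[OF bounded_cball] by blast
  moreover have "smooth ?\<phi>"
    unfolding smooth_def by (intro allI C_k_mult C_k_const) (use \<eta>(1) in \<open>simp add: smooth_def\<close>)
  ultimately have "test_fun \<Omega> ?\<phi>"
    using supp s(2) unfolding test_fun_def by blast
  moreover have "?\<phi> y \<le> u y" if "y \<in> \<Omega>" for y
  proof (cases "y \<in> cball x s")
    case True
    then have "u x / 2 < u y" using s(2) by auto
    moreover have "?\<phi> y \<le> u x / 2" using \<eta>(3)[of y] x by auto
    ultimately show ?thesis by linarith
  next
    case False
    then have "\<eta> y = 0" using \<eta>(5) closure_subset[of "{y. \<eta> y \<noteq> 0}"] by (auto simp: supp_def)
    then show ?thesis using assms(3) that by simp
  qed
  then have "AE y in lebesgue_on \<Omega>. ?\<phi> y \<le> u y" by (intro AE_I2) auto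
  moreover have "0 < ?\<phi> x" using \<eta>(4) x by simp
  moreover have "\<forall>y. 0 \<le> ?\<phi> y" using \<eta>(2) x by simp
  ultimately show "x \<in> positivity_set \<Omega> u" unfolding positivity_set_def using x by blast
qed

lemma C1_lipschitz_on_compact:
  fixes v :: "'a::euclidean_space \<Rightarrow> real"
  assumes v: "C_k 1 v" and K: "compact K"
  shows "\<exists>C. C-lipschitz_on K v"
proof -
  obtain r where r: "K \<subseteq> cball 0 r" using compact_imp_bounded[OF K] by (auto simp: bounded_iff subset_iff)
  have d: "v differentiable (at x)" and c: "i \<in> Basis \<Longrightarrow> continuous_on UNIV (pd i v)" for x i
    using v by (auto simp: C_k_Suc C_k_0 One_nat_def)
  have "continuous_on UNIV (\<lambda>x. \<Sum>i\<in>Basis. \<bar>pd i v x\<bar>)"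
    using c by (intro continuous_on_sum continuous_on_rabs)
  then have "continuous_on (cball 0 r) (\<lambda>x. \<Sum>i\<in>Basis. \<bar>pd i v x\<bar>)"
    by (rule continuous_on_subset) simp
  then obtain M where M: "\<forall>x\<in>cball 0 r. \<bar>\<Sum>i\<in>Basis. \<bar>pd i v x\<bar>\<bar> \<le> M"
    using continuous_bounded_on_compact[OF _ compact_cball] by blast
  have bound: "\<bar>pd h v x\<bar> \<le> \<bar>M\<bar> * norm h" if "x \<in> cball 0 r" for x h
  proof -
    have lin: "linear (\<lambda>h. pd h v x)" by (rule has_derivative_linear[OF has_derivative_pd[OF d]])
    have "pd h v x = pd (\<Sum>i\<in>Basis. (h \<bullet> i) *\<^sub>R i) v x" by (simp add: euclidean_representation)
    also have "\<dots> = (\<Sum>i\<in>Basis. (h \<bullet> i) * pd i v x)"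
      by (simp add: linear_sum[OF lin] linear_cmul[OF lin] del: euclidean_representation)
    finally have "\<bar>pd h v x\<bar> \<le> (\<Sum>i\<in>Basis. \<bar>(h \<bullet> i) * pd i v x\<bar>)" by (simp add: sum_abs)
    also have "\<dots> \<le> (\<Sum>i\<in>Basis. norm h * \<bar>pd i v x\<bar>)"
      by (intro sum_mono) (simp add: abs_mult mult_right_mono Basis_le_norm)
    also have "\<dots> = norm h * (\<Sum>i\<in>Basis. \<bar>pd i v x\<bar>)" by (simp add: sum_distrib_left)
    also have "\<dots> \<le> norm h * \<bar>M\<bar>" using M that by (intro mult_left_mono) force+
    finally show ?thesis by (simp add: mult.commute)
  qed
  have "norm (v x - v y) \<le> \<bar>M\<bar> * norm (x - y)" if "x \<in> cball 0 r" "y \<in> cball 0 r" for x y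
  proof (rule differentiable_bound[where S = "cball 0 r" and f' = "\<lambda>x h. pd h v x"])
    show "(v has_derivative (\<lambda>h. pd h v x)) (at x within cball 0 r)" for x
      using has_derivative_pd[OF d] by (rule has_derivative_at_withinI)
    show "onorm (\<lambda>h. pd h v x) \<le> \<bar>M\<bar>" if "x \<in> cball 0 r" for x
      using bound[OF that] by (intro onorm_le) simp
  qed (use that in auto)
  then have "\<bar>M\<bar>-lipschitz_on K v"
    using r by (auto simp: lipschitz_on_def dist_norm subset_iff)
  then show ?thesis ..
qed

text \<open>Precomposing with the metric projection onto a closed ball, which is \<open>1\<close>-Lipschitz, does not change
  \<open>u\<close>: points outside the ball go to its boundary sphere, where \<open>u\<close> vanishes as well.\<close>
lemma C01_loc_extend_by_zero:
  fixes u :: "'a::euclidean_space \<Rightarrow> real"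
  assumes loc: "C01_loc \<Omega> u" and K: "cball a r \<subseteq> \<Omega>" "0 < r"
    and z: "\<And>x. x \<notin> ball a r \<Longrightarrow> u x = 0"
  shows "\<exists>C. C-lipschitz_on UNIV u"
proof -
  let ?p = "closest_point (cball a r)"
  obtain C where C: "C-lipschitz_on (cball a r) u"
    using loc K unfolding C01_loc_def by (meson compact_cball)
  have ne: "cball a r \<noteq> {}" using K by simp
  have up: "u (?p x) = u x" for x
  proof (cases "x \<in> cball a r")
    case False
    have "affine hull cball a r = UNIV" using K(2) by (intro affine_hull_nonempty_interior) auto
    with False have "x \<in> affine hull cball a r - rel_interior (cball a r)"
      using rel_interior_subset by blast
    then have "?p x \<in> rel_frontier (cball a r)"
      by (intro closest_point_in_rel_frontier closed_cball ne)
    then have "?p x \<notin> ball a r" using K(2) by (auto simp: rel_frontier_cball)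
    moreover have "x \<notin> ball a r" using False by auto
    ultimately show ?thesis using z by simp
  qed (simp add: closest_point_self)
  have "1-lipschitz_on UNIV ?p"
    using ne by (auto simp: lipschitz_on_def intro!: closest_point_lipschitz)
  moreover have "C-lipschitz_on (?p ` UNIV) u"
    using C by (rule lipschitz_on_subset) (use closest_point_in_set[OF closed_cball ne] in auto)
  ultimately have "(C * 1)-lipschitz_on UNIV (u \<circ> ?p)" by (intro lipschitz_on_compose)
  then have "C-lipschitz_on UNIV u" using up by (simp add: comp_def)
  then show ?thesis ..
qed

lemma compact_subset_smaller_ball:
  fixes K :: "'a::real_normed_vector set"
  assumes "compact K" "K \<subseteq> ball 0 R" "0 < R"
  shows "\<exists>r. 0 < r \<and> r < R \<and> K \<subseteq> ball 0 r"
proof (cases "K = {}")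
  case True
  then show ?thesis using assms(3) by (intro exI[of _ "R / 2"]) auto
next
  case False
  then obtain x where x: "x \<in> K" "\<forall>y\<in>K. norm y \<le> norm x"
    using continuous_attains_sup[OF assms(1) False, of norm] by (auto intro: continuous_intros)
  then have "norm x < R" using assms(2) by auto
  then have "K \<subseteq> ball 0 ((norm x + R) / 2)" using x(2) by fastforce
  moreover have "0 < norm x + R" using assms(3) norm_ge_zero[of x] by linarith
  ultimately show ?thesis using \<open>norm x < R\<close> by (intro exI[of _ "(norm x + R) / 2"]) auto
qed

section \<open>The transmission problem\<close>

text \<open>Compactness of \<open>frontier D\<close> gives \<open>u0 > \<delta> > 0\<close> there. Inside \<open>D\<close>, replace \<open>u0\<close> by
  \<open>\<sigma> (u0) * u0 + (1 - \<sigma> (u0))\<close> with a smooth step \<open>\<sigma>\<close> from \<open>0\<close> below \<open>\<delta> / 2\<close> to \<open>1\<close> above \<open>\<delta>\<close>. This is a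
  convex combination of \<open>u0\<close> and \<open>1\<close> that uses \<open>u0\<close> only where it exceeds \<open>\<delta> / 2\<close>, and it equals \<open>u0\<close>
  where \<open>u0 > \<delta>\<close>, in particular near \<open>frontier D\<close>, so the result stays \<open>C\<^sup>2\<close> across the boundary.\<close>
lemma positive_C2_modification:
  fixes u0 :: "'a::euclidean_space \<Rightarrow> real"
  assumes D: "open D" "bounded D" and u0: "C_k 2 u0" and pos: "\<forall>x\<in>frontier D. 0 < u0 x"
  shows "\<exists>v W m. C_k 2 v \<and> open W \<and> - D \<subseteq> W \<and> (\<forall>x\<in>W. v x = u0 x) \<and>
    (\<forall>x. x \<notin> D \<longrightarrow> v x = u0 x) \<and> 0 < m \<and> (\<forall>x\<in>D. m \<le> v x)"
proof -
  have c: "continuous_on UNIV u0" by (rule C_k_continuous[OF u0])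
  obtain \<delta> where \<delta>: "0 < \<delta>" "\<forall>x\<in>frontier D. \<delta> < u0 x"
  proof (cases "frontier D = {}")
    case True
    then show ?thesis using that[of 1] by simp
  next
    case False
    have "compact (frontier D)" using D(2) by (simp add: compact_frontier_bounded)
    then obtain x where x: "x \<in> frontier D" "\<forall>y\<in>frontier D. u0 x \<le> u0 y"
      using continuous_attains_inf[OF _ False continuous_on_subset[OF c]] by blast
    then have "0 < u0 x" using pos by blast
    with x show ?thesis using that[of "u0 x / 2"] by fastforce
  qed
  obtain \<sigma> :: "real \<Rightarrow> real" where \<sigma>: "smooth \<sigma>" "\<And>t. 0 \<le> \<sigma> t" "\<And>t. \<sigma> t \<le> 1"
    "\<And>t. t \<le> \<delta> / 2 \<Longrightarrow> \<sigma> t = 0" "\<And>t. \<delta> \<le> t \<Longrightarrow> \<sigma> t = 1"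
    using smooth_step_exists[of "\<delta> / 2" \<delta>] \<delta>(1) by auto
  define F where "F x = \<sigma> (u0 x) * u0 x + (1 - \<sigma> (u0 x))" for x
  define v where "v x = (if x \<in> D then F x else u0 x)" for x
  define W where "W = - closure D \<union> {x \<in> UNIV. \<delta> < u0 x}"
  define m where "m = min 1 (\<delta> / 2)"
  have oW: "open W" unfolding W_def using c by (intro open_Un open_superlevel) auto
  have cov: "- D \<subseteq> W" using \<delta>(2) D(1) by (auto simp: W_def frontier_def interior_open)
  have vW: "v x = u0 x" if "x \<in> W" for x
  proof (cases "x \<in> D")
    case True
    then have "x \<in> closure D" using closure_subset by blast
    then have "\<delta> < u0 x" using that by (auto simp: W_def)
    then show ?thesis by (simp add: v_def F_def \<sigma>(5))
  qed (simp add: v_def)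
  have "C_k 2 \<sigma>" using \<sigma>(1) by (simp add: smooth_def)
  then have "C_k 2 (\<lambda>x. \<sigma> (u0 x))" by (rule C_k_compose[OF _ u0])
  from C_k_add[OF C_k_mult[OF this u0] C_k_diff[OF C_k_const[of _ 1] this]]
  have F: "C_k 2 F" by (simp add: F_def[abs_def])
  have "W \<union> D = UNIV" using cov by blast
  then have "C_k 2 v"
    by (rule C_k_glue[OF oW D(1) _ u0 F]) (simp_all only: vW, simp add: v_def)
  moreover have "m \<le> v x" if "x \<in> D" for x
  proof (cases "u0 x \<le> \<delta> / 2")
    case True
    then show ?thesis using that by (simp add: v_def F_def \<sigma>(4) m_def)
  next
    case False
    then have "\<sigma> (u0 x) * m \<le> \<sigma> (u0 x) * u0 x" "(1 - \<sigma> (u0 x)) * m \<le> (1 - \<sigma> (u0 x)) * 1"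
      using \<sigma>(2,3) by (intro mult_left_mono; simp add: m_def)+
    then show ?thesis using that by (simp add: v_def F_def algebra_simps)
  qed
  moreover have "0 < m" using \<delta>(1) by (simp add: m_def)
  moreover have "\<forall>x. x \<notin> D \<longrightarrow> v x = u0 x" by (simp add: v_def)
  ultimately show ?thesis using oW cov vW by blast
qed

text \<open>Let \<open>S\<close> be the surface measure on \<open>frontier D\<close>, so that \<open>(\<Delta> + k\<^sup>2) w = q + g S\<close>. With \<open>v\<close> the
  positive modification of \<open>u0\<close>, the sum \<open>u = v + w\<close> satisfies \<open>(\<Delta> + k0\<^sup>2) u = F + g S\<close>, where \<open>F\<close> is a bounded function
  vanishing off \<open>D\<close>; as \<open>u\<close> is bounded away from \<open>0\<close> on \<open>D\<close>, the potential \<open>- F / u\<close> absorbs it. Near the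
  boundary \<open>v = u0\<close> contributes nothing to \<open>F\<close> and \<open>w\<close> is small, so \<open>F\<close> inherits the lower bound of \<open>q\<close>.\<close>
lemma transmission_potential:
  fixes D :: "'a::euclidean_space set" and w q u0 g :: "'a \<Rightarrow> real"
  assumes D: "open D" "closure D \<subseteq> ball 0 R" and R: "0 < R"
    and w: "C01_loc (ball 0 R) w" "\<And>x. 0 \<le> w x" "\<And>x. x \<notin> D \<Longrightarrow> w x = 0"
    and q: "q \<in> borel_measurable lebesgue" "AE x in lebesgue. \<bar>q x\<bar> \<le> C" "\<And>x. x \<notin> D \<Longrightarrow> q x = 0"
    and N: "open N" "frontier D \<subseteq> N" "0 < b" "AE x in lebesgue. x \<in> D \<inter> N \<longrightarrow> b \<le> q x"
    and eq: "\<And>\<phi>. test_fun (ball 0 R) \<phi> \<Longrightarrow>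
      helmholtz_dist k w \<phi> = (LINT x|lebesgue. q x * \<phi> x) + (LINT x|boundary_measure D. g x * \<phi> x)"
    and u0: "C_k 2 u0" "\<And>x. lap u0 x + k0\<^sup>2 * u0 x = 0" "\<forall>x\<in>frontier D. 0 < u0 x"
  shows "\<exists>\<rho> u. L_infty lebesgue \<rho> \<and>
           (\<exists>c>0. \<exists>U. open U \<and> frontier D \<subseteq> U \<and> (AE x in lebesgue. x \<in> U \<longrightarrow> c \<le> \<bar>\<rho> x\<bar>)) \<and>
           C01_loc UNIV u \<and>
           (\<forall>\<phi>. test_fun UNIV \<phi> \<longrightarrow>
              helmholtz_dist k0 u \<phi> + (LINT x|lebesgue. \<rho> x * indicator D x * u x * \<phi> x) =
              (LINT x|boundary_measure D. g x * \<phi> x)) \<and>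
           (\<forall>x. x \<notin> D \<longrightarrow> u x = u0 x)"
proof -
  have bD: "bounded D" using D(2) bounded_subset[OF bounded_ball] closure_subset by (metis order_trans)
  have cD: "compact (closure D)" using bD by (simp add: compact_closure)
  obtain r where r: "0 < r" "r < R" "closure D \<subseteq> ball 0 r"
    using compact_subset_smaller_ball[OF cD D(2) R] by blast
  have Dr: "D \<subseteq> ball 0 r" using r(3) closure_subset by blast
  have fr: "frontier D \<subseteq> ball 0 r" using r(3) by (auto simp: frontier_def)
  obtain L where L: "L-lipschitz_on UNIV w"
    using C01_loc_extend_by_zero[OF w(1), of 0 r] r Dr w(3) by fastforce
  then have cw: "continuous_on UNIV w" by (rule lipschitz_on_continuous_on)
  obtain v W m where v: "C_k 2 v" "open W" "- D \<subseteq> W" "\<And>x. x \<in> W \<Longrightarrow> v x = u0 x"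
    "\<And>x. x \<notin> D \<Longrightarrow> v x = u0 x" "0 < m" "\<And>x. x \<in> D \<Longrightarrow> m \<le> v x"
    using positive_C2_modification[OF D(1) bD u0(1,3)] by blast
  have cv: "continuous_on UNIV v" by (rule C_k_continuous[OF v(1)])
  have pos: "0 < v x + w x" if "x \<in> D" for x using v(6,7) w(2)[of x] that by fastforce
  define G where "G x = lap v x + k0\<^sup>2 * v x" for x
  have cG: "continuous_on UNIV G"
    unfolding G_def using continuous_on_lap[OF v(1)] cv by (intro continuous_intros)
  have GW: "G x = 0" if "x \<in> W" for x
  proof -
    have "lap v x = lap u0 x" by (rule lap_cong_open[OF v(2) that]) (rule v(4))
    then show ?thesis using u0(2)[of x] v(4)[OF that] by (simp add: G_def)
  qed
  define F where "F x = G x + (k0\<^sup>2 - k\<^sup>2) * w x + q x" for x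
  have F0: "F x = 0" if "x \<notin> D" for x
    using that v(3) GW w(3) q(3) by (auto simp: F_def)
  \<comment> \<open>The value \<open>1\<close> off \<open>D\<close> provides the lower bound on the outer side of the boundary.\<close>
  define \<rho> where "\<rho> x = (if x \<in> D then - F x / (v x + w x) else 1)" for x
  define u where "u x = v x + w x" for x
  have \<rho>u: "\<rho> x * indicator D x * u x = - F x" for x
    using pos[of x] F0[of x] by (cases "x \<in> D") (auto simp: \<rho>_def u_def)
  have c1: "continuous_on UNIV (\<lambda>x. G x + (k0\<^sup>2 - k\<^sup>2) * w x)"
    using cG cw by (intro continuous_intros)
  have "\<rho> \<in> borel_measurable lebesgue"
  proof -
    have "F \<in> borel_measurable lebesgue"
      unfolding F_def[abs_def] by (intro borel_measurable_add continuous_measurable_lebesgue[OF c1] q(1))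
    moreover have "(\<lambda>x. v x + w x) \<in> borel_measurable lebesgue"
      using cv cw by (intro continuous_measurable_lebesgue continuous_on_add)
    moreover have "{x \<in> space lebesgue. x \<in> D} \<in> sets lebesgue" using D(1) by simp
    ultimately show ?thesis unfolding \<rho>_def[abs_def]
      by (intro measurable_If borel_measurable_divide borel_measurable_uminus borel_measurable_const)
  qed
  moreover have "\<exists>B. AE x in lebesgue. \<bar>\<rho> x\<bar> \<le> B"
  proof -
    obtain M where M: "\<forall>x\<in>closure D. \<bar>G x + (k0\<^sup>2 - k\<^sup>2) * w x\<bar> \<le> M"
      using continuous_bounded_on_compact[OF continuous_on_subset[OF c1] cD] by blast
    from q(2) have "AE x in lebesgue. \<bar>\<rho> x\<bar> \<le> max 1 ((M + C) / m)"
    proof eventually_elim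
      case (elim x)
      show ?case
      proof (cases "x \<in> D")
        case True
        then have "\<bar>G x + (k0\<^sup>2 - k\<^sup>2) * w x\<bar> \<le> M" using M closure_subset by blast
        then have "\<bar>F x\<bar> \<le> M + C" using elim by (simp add: F_def)
        moreover have "m \<le> v x + w x" using v(7)[OF True] w(2)[of x] by simp
        ultimately have "\<bar>F x\<bar> / (v x + w x) \<le> (M + C) / m" using v(6) by (intro frac_le) auto
        then show ?thesis using pos[OF True] True by (simp add: \<rho>_def abs_divide)
      qed (simp add: \<rho>_def)
    qed
    then show ?thesis ..
  qed
  moreover have "\<exists>c>0. \<exists>U. open U \<and> frontier D \<subseteq> U \<and> (AE x in lebesgue. x \<in> U \<longrightarrow> c \<le> \<bar>\<rho> x\<bar>)"
  proof -
    obtain M where M: "0 < M" "\<forall>x\<in>closure D. \<bar>v x + w x\<bar> \<le> M"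
      using continuous_bounded_on_compact[OF continuous_on_subset[OF continuous_on_add[OF cv cw]] cD] by blast
    \<comment> \<open>On \<open>U\<close> the term \<open>(k0\<^sup>2 - k\<^sup>2) * w\<close>, of either sign, costs at most half of the bound \<open>b\<close>.\<close>
    define U where "U = N \<inter> W \<inter> {x \<in> UNIV. - (b / 2) < (k0\<^sup>2 - k\<^sup>2) * w x}"
    have "continuous_on UNIV (\<lambda>x. (k0\<^sup>2 - k\<^sup>2) * w x)" using cw by (intro continuous_intros)
    then have "open U" unfolding U_def using N(1) v(2) by (intro open_Int open_superlevel) auto
    moreover have "frontier D \<inter> D = {}" using D(1) by (auto simp: frontier_def interior_open)
    then have "frontier D \<subseteq> U" using N(2,3) v(3) w(3) by (auto simp: U_def disjoint_iff)
    moreover from N(4) have "AE x in lebesgue. x \<in> U \<longrightarrow> min 1 (b / 2 / M) \<le> \<bar>\<rho> x\<bar>"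
    proof eventually_elim
      case (elim x)
      show ?case
      proof (intro impI, cases "x \<in> D")
        case True
        assume x: "x \<in> U"
        then have "b / 2 \<le> F x" using elim True GW[of x] by (simp add: F_def U_def)
        moreover have "v x + w x \<le> M" using M(2) True closure_subset by fastforce
        ultimately have "b / 2 / M \<le> F x / (v x + w x)"
          using pos[OF True] N(3) by (intro frac_le) auto
        moreover have "0 \<le> F x" using \<open>b / 2 \<le> F x\<close> N(3) by linarith
        ultimately show "min 1 (b / 2 / M) \<le> \<bar>\<rho> x\<bar>" using pos[OF True] True
          by (simp add: \<rho>_def abs_divide min.coboundedI2)
      qed (simp add: \<rho>_def)
    qed
    moreover have "0 < min 1 (b / 2 / M)" using N(3) M(1) by simp
    ultimately show ?thesis by blast
  qed
  moreover have "C01_loc UNIV u"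
    unfolding C01_loc_def
  proof (intro allI impI)
    fix K :: "'a set" assume "compact K \<and> K \<subseteq> UNIV"
    moreover have "C_k 1 v" using v(1) C_k_lower[of 1 v] by (simp add: numeral_2_eq_2)
    ultimately obtain L' where "L'-lipschitz_on K v" using C1_lipschitz_on_compact by blast
    then have "(L' + L)-lipschitz_on K u"
      unfolding u_def by (intro lipschitz_on_add lipschitz_on_subset[OF L]) auto
    then show "\<exists>C. C-lipschitz_on K u" ..
  qed
  moreover have "helmholtz_dist k0 u \<phi> + (LINT x|lebesgue. \<rho> x * indicator D x * u x * \<phi> x) =
      (LINT x|boundary_measure D. g x * \<phi> x)" if \<phi>: "test_fun UNIV \<phi>" for \<phi>
  proof -
    note t = test_fun_realD(2,3)[OF \<phi>] and tl = test_fun_realD(4,5)[OF \<phi>]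
    have iG: "integrable lebesgue (\<lambda>x. G x * \<phi> x)" and iw: "integrable lebesgue (\<lambda>x. w x * \<phi> x)"
      by (rule integrable_continuous_mult_test[OF _ t], fact)+
    have iq: "integrable lebesgue (\<lambda>x. q x * \<phi> x)" by (rule integrable_bounded_mult_test[OF q(1,2) t])
    have "(LINT x|lebesgue. \<rho> x * indicator D x * u x * \<phi> x)
        = (LINT x|lebesgue. - (G x * \<phi> x + (k0\<^sup>2 - k\<^sup>2) * (w x * \<phi> x) + q x * \<phi> x))"
      by (simp only: \<rho>u) (simp add: F_def algebra_simps)
    also have "\<dots> = - ((LINT x|lebesgue. G x * \<phi> x) + (k0\<^sup>2 - k\<^sup>2) * (LINT x|lebesgue. w x * \<phi> x)
        + (LINT x|lebesgue. q x * \<phi> x))"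
      using iG iw iq by simp
    finally have 1: "(LINT x|lebesgue. \<rho> x * indicator D x * u x * \<phi> x) = \<dots>" .
    have "helmholtz_dist k0 u \<phi> = helmholtz_dist k0 v \<phi> + helmholtz_dist k0 w \<phi>"
      using helmholtz_dist_add[OF cv cw \<phi>] by (simp add: u_def[abs_def])
    also have "helmholtz_dist k0 v \<phi> = (LINT x|lebesgue. G x * \<phi> x)"
      unfolding G_def by (rule helmholtz_dist_C2[OF v(1) \<phi>])
    also have "helmholtz_dist k0 w \<phi> = helmholtz_dist k w \<phi> + (k0\<^sup>2 - k\<^sup>2) * (LINT x|lebesgue. w x * \<phi> x)"
      unfolding helmholtz_dist_split[OF cw \<phi>] by (simp add: algebra_simps)
    also have "helmholtz_dist k w \<phi> = (LINT x|lebesgue. q x * \<phi> x) + (LINT x|boundary_measure D. g x * \<phi> x)"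
      by (rule helmholtz_dist_global[OF r(1,2) Dr w(3) q(3) eq fr \<phi>])
    finally show ?thesis using 1 by simp
  qed
  moreover have "\<forall>x. x \<notin> D \<longrightarrow> u x = u0 x" using v(5) w(3) by (simp add: u_def)
  ultimately show ?thesis unfolding L_infty_def by blast
qed

theorem theorem2p4:
  fixes \<mu> :: "'a::euclidean_space measure"
    and b b0 \<beta> \<epsilon> k R Cn k0 n j :: real
    and g h mut ustar u0 :: "'a \<Rightarrow> real"
    and D :: "'a set"
  defines "n \<equiv> real DIM('a)"
    and "j \<equiv> bessel_zero ((n - 2) / 2)"
  assumes "DIM('a) \<ge> 2"
    \<comment> \<open>parameters\<close>
    and "0 < b" and "b \<le> b0" and "0 < \<beta>" and "\<beta> < j" and "0 < \<epsilon>" and "\<epsilon> < \<beta>"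
    and "sets \<mu> = sets borel" and "finite_measure \<mu>" and "emeasure \<mu> (- ball 0 \<epsilon>) = 0"
    and "Cn \<ge> 2 powr n * ((3 * pi) powr (n / 2) / Gamma (1 + n / 2)) *
               (bessel_J (n / 2) j / bessel_J (n / 2) (j / 3))"
    and "measure \<mu> UNIV > Cn * b0 * \<epsilon> powr n"
    and "0 < k"
    and "k < min (1 / 3)
               ((((4 * pi / 3) powr (n / 2) * \<beta> powr (n / 2) * bessel_J (n / 2) \<beta> *
                  (bessel_J (n / 2) (2 / 3 * j) / bessel_J (n / 2) j)) * b / measure \<mu> UNIV)
                powr (1 / n))"
    and "R = \<beta> / k"
    and "h \<in> borel_measurable (lebesgue_on (ball 0 R))"
    and "AE x in lebesgue_on (ball 0 R). b \<le> h x \<and> h x \<le> b0"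
    and "L_infty (lebesgue_on (ball 0 R)) g" and "\<forall>x\<in>ball 0 R. 0 \<le> g x"
    and "W1p 1 (ball 0 R) (\<lambda>x. (g x)\<^sup>2)"
    and "frontier {x\<in>ball 0 R. 0 < g x} \<inter> ball 0 R \<noteq> {} \<longrightarrow>
           (\<exists>\<alpha>. 0 < \<alpha> \<and> \<alpha> \<le> 1 \<and>
              (\<exists>U. open U \<and> U \<subseteq> ball 0 R \<and>
                 frontier {x\<in>ball 0 R. 0 < g x} \<inter> ball 0 R \<subseteq> U \<and> hoelder_loc \<alpha> U g) \<and>
              emeasure (hausdorff_measure (n - 1 + \<alpha>))
                (frontier {x\<in>ball 0 R. 0 < g x} \<inter> ball 0 R) = 0)"
    \<comment> \<open>the objects furnished by the construction\<close>
    and "\<forall>x. mut x = measure_conv \<mu> (mean_kernel k (2 * \<epsilon>)) x"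
    and "\<forall>x. 0 \<le> mut x" and "L_infty (lebesgue_on D) mut"
    and "compact (supp mut)" and "supp mut \<subseteq> D"
    and "bounded D" and "open D" and "connected D" and "closure D \<subseteq> ball 0 R"
    and "hybrid_quadrature_domain k D (measure_dist \<mu>) g h"
    and "\<forall>x. 0 \<le> ustar x" and "\<forall>x. x \<notin> ball 0 R \<longrightarrow> ustar x = 0"
    and "C01_loc (ball 0 R) ustar"
    and "D = positivity_set (ball 0 R) ustar"
    and "energy_minimizer k (ball 0 R) (\<lambda>x. mut x - h x * indicator D x) g ustar"
    and "\<forall>\<phi>. test_fun (ball 0 R) \<phi> \<longrightarrow>
           helmholtz_dist k ustar \<phi> =
             - (LINT x|lebesgue. mut x * \<phi> x) + (LINT x|lebesgue_on D. h x * \<phi> x)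
             + (LINT x|boundary_measure D. g x * \<phi> x)"
    \<comment> \<open>the Helmholtz solution\<close>
    and "k0 \<ge> 0" and "C_k 2 u0" and "\<forall>x. lap u0 x + k0\<^sup>2 * u0 x = 0"
    and "\<forall>x\<in>frontier D. 0 < u0 x"
  shows "\<exists>\<rho> u. L_infty lebesgue \<rho> \<and>
           (\<exists>c>0. \<exists>U. open U \<and> frontier D \<subseteq> U \<and> (AE x in lebesgue. x \<in> U \<longrightarrow> c \<le> \<bar>\<rho> x\<bar>)) \<and>
           C01_loc UNIV u \<and>
           (\<forall>\<phi>. test_fun UNIV \<phi> \<longrightarrow>
              helmholtz_dist k0 u \<phi> + (LINT x|lebesgue. \<rho> x * indicator D x * u x * \<phi> x) =
              (LINT x|boundary_measure D. g x * \<phi> x)) \<and>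
           (\<forall>x. x \<notin> D \<longrightarrow> u x = u0 x)"
proof -
  have "0 < R" using \<open>R = \<beta> / k\<close> \<open>0 < \<beta>\<close> \<open>0 < k\<close> by simp
  have mut0: "mut x = 0" if "x \<notin> D" for x
    using \<open>supp mut \<subseteq> D\<close> that supp_zero by blast
  have DB: "D \<subseteq> ball 0 R" using \<open>closure D \<subseteq> ball 0 R\<close> closure_subset by blast
  have mD: "D \<in> sets lebesgue" using \<open>open D\<close> by simp
  have w0: "ustar x = 0" if "x \<notin> D" for x
  proof -
    have "D = {x \<in> ball 0 R. 0 < ustar x}"
      using \<open>D = positivity_set (ball 0 R) ustar\<close> \<open>\<forall>x. 0 \<le> ustar x\<close>
        positivity_set_continuous[OF open_ball C01_loc_continuous_on[OF \<open>C01_loc (ball 0 R) ustar\<close> open_ball]]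
      by simp
    then have "x \<notin> ball 0 R \<or> ustar x \<le> 0" using that by auto
    then show ?thesis
      using \<open>\<forall>x. 0 \<le> ustar x\<close> \<open>\<forall>x. x \<notin> ball 0 R \<longrightarrow> ustar x = 0\<close> by (meson order_antisym)
  qed
  define H where "H x = (if x \<in> D then h x else 0)" for x
  have H: "H \<in> borel_measurable lebesgue"
  proof -
    have "h \<in> borel_measurable (lebesgue_on D)"
      by (rule measurable_restrict_mono[OF \<open>h \<in> borel_measurable (lebesgue_on (ball 0 R))\<close> DB])
    then show ?thesis unfolding H_def[abs_def] using borel_measurable_if[OF mD] by blast
  qed
  have Hb: "AE x in lebesgue. x \<in> D \<longrightarrow> b \<le> h x \<and> h x \<le> b0"
  proof -
    have "AE x in lebesgue. x \<in> ball 0 R \<longrightarrow> b \<le> h x \<and> h x \<le> b0"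
      using \<open>AE x in lebesgue_on (ball 0 R). b \<le> h x \<and> h x \<le> b0\<close>
      by (subst (asm) AE_restrict_space_iff) auto
    then show ?thesis by eventually_elim (use DB in auto)
  qed
  have mut: "mut \<in> borel_measurable lebesgue"
  proof -
    have "(\<lambda>x. if x \<in> D then mut x else 0) \<in> borel_measurable lebesgue"
      using \<open>L_infty (lebesgue_on D) mut\<close> borel_measurable_if[OF mD] unfolding L_infty_def by blast
    moreover have "(\<lambda>x. if x \<in> D then mut x else 0) = mut" using mut0 by auto
    ultimately show ?thesis by simp
  qed
  obtain Cm where Cm: "AE x in lebesgue. x \<in> D \<longrightarrow> \<bar>mut x\<bar> \<le> Cm"
  proof -
    obtain C where "AE x in lebesgue_on D. \<bar>mut x\<bar> \<le> C"
      using \<open>L_infty (lebesgue_on D) mut\<close> unfolding L_infty_def by blast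
    then show ?thesis using that mD by (subst (asm) AE_restrict_space_iff) auto
  qed
  \<comment> \<open>As \<open>mut\<close> has compact support in \<open>D\<close>, near \<open>frontier D\<close> only \<open>h \<ge> b\<close> remains of \<open>q\<close>.\<close>
  define q where "q x = H x - mut x" for x
  have q: "q \<in> borel_measurable lebesgue"
    unfolding q_def[abs_def] using H mut by (rule borel_measurable_diff)
  have AEH: "AE x in lebesgue. \<bar>H x\<bar> \<le> b0"
    using Hb by eventually_elim (use \<open>0 < b\<close> \<open>b \<le> b0\<close> in \<open>auto simp: H_def\<close>)
  have AEm: "AE x in lebesgue. \<bar>mut x\<bar> \<le> max 0 Cm"
    using Cm by eventually_elim (use mut0 in fastforce)
  have qb: "AE x in lebesgue. \<bar>q x\<bar> \<le> b0 + max 0 Cm"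
    using AEH AEm by eventually_elim (simp add: q_def)
  have q0: "q x = 0" if "x \<notin> D" for x using that mut0 by (simp add: q_def H_def)
  have "frontier D \<inter> D = {}" using \<open>open D\<close> by (auto simp: frontier_def interior_open)
  then have N: "open (- supp mut)" "frontier D \<subseteq> - supp mut"
    using \<open>supp mut \<subseteq> D\<close> by (auto simp: supp_def)
  have Nb: "AE x in lebesgue. x \<in> D \<inter> - supp mut \<longrightarrow> b \<le> q x"
    using Hb by eventually_elim (auto simp: q_def H_def supp_zero)
  have eq: "helmholtz_dist k ustar \<phi> = (LINT x|lebesgue. q x * \<phi> x) + (LINT x|boundary_measure D. g x * \<phi> x)"
    if \<phi>: "test_fun (ball 0 R) \<phi>" for \<phi>
  proof -
    note t = test_fun_realD(2,3)[OF \<phi>]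
    have "(LINT x|lebesgue_on D. h x * \<phi> x) = (LINT x|lebesgue. H x * \<phi> x)"
      using mD by (subst integral_restrict_space)
        (auto simp: H_def intro!: Bochner_Integration.integral_cong)
    then show ?thesis
      using that \<open>\<forall>\<phi>. test_fun (ball 0 R) \<phi> \<longrightarrow>
           helmholtz_dist k ustar \<phi> =
             - (LINT x|lebesgue. mut x * \<phi> x) + (LINT x|lebesgue_on D. h x * \<phi> x)
             + (LINT x|boundary_measure D. g x * \<phi> x)\<close>
        integrable_bounded_mult_test[OF H AEH t] integrable_bounded_mult_test[OF mut AEm t]
      by (simp add: q_def left_diff_distrib)
  qed
  have w: "C01_loc (ball 0 R) ustar" "\<And>x. 0 \<le> ustar x" using assms by blast+
  have u0: "\<And>x. lap u0 x + k0\<^sup>2 * u0 x = 0" using assms by blast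
  show ?thesis
    by (rule transmission_potential[OF \<open>open D\<close> \<open>closure D \<subseteq> ball 0 R\<close> \<open>0 < R\<close> w w0 q qb q0
          N \<open>0 < b\<close> Nb eq \<open>C_k 2 u0\<close> u0 \<open>\<forall>x\<in>frontier D. 0 < u0 x\<close>])
qed

end
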